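(* Let $\mathcal{H},\mathcal{K}$ be Hilbert spaces, let $\tau\in\mathcal{T}(\mathcal{K})$ be a state, let $U$ be a unitary operator on $\mathcal{K}\otimes\mathcal{H}$, and let $\psi_0,\psi_1\in\mathcal{H}$ be unit vectors. Let $T:\mathcal{T}(\mathcal{H})\to\mathcal{T}(\mathcal{K}\otimes\mathcal{H})$, $T(\rho)=U(\tau\otimes\rho)U^*$, satisfy $\operatorname{tr}((Q\otimes\mathbf 1)T(|\psi_0\rangle\langle\psi_0|))=0$ and $\operatorname{tr}((Q\otimes\mathbf 1)T(|\psi_1\rangle\langle\psi_1|))=1$ for some orthogonal projection $Q$ on $\mathcal{K}$. Define $M:\mathcal{T}(\mathcal{H})\to\mathcal{T}(\mathcal{H})\oplus\mathcal{T}(\mathcal{H})$ by $$M(\rho):=\operatorname{tr}_{\mathcal{K}}\bigl(((\mathbf 1-Q)\otimes\mathbf 1)T(\rho)\bigr)\oplus\operatorname{tr}_{\mathcal{K}}\bigl((Q\otimes\mathbf 1)T(\rho)\bigr).$$ Then for $\psi=\alpha_0\psi_0+\alpha_1\psi_1$ (with $\alpha_0,\alpha_1\in\mathbb{C}$) we have $$M(|\psi\rangle\langle\psi|)=|\alpha_0|^2\,\operatorname{tr}_{\mathcal{K}}T(|\psi_0\rangle\langle\psi_0|)\oplus|\alpha_1|^2\,\operatorname{tr}_{\mathcal{K}}T(|\psi_1\rangle\langle\psi_1|).$$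
   Context: Hilbert spaces are complex; $\mathcal{T}(\mathcal{H})$ is the space of trace class operators on $\mathcal{H}$; a state is a positive trace class operator of trace $1$; $\operatorname{tr}_{\mathcal{K}}:\mathcal{T}(\mathcal{K}\otimes\mathcal{H})\to\mathcal{T}(\mathcal{H})$ is the partial trace over $\mathcal{K}$. *)

theory Defs
  imports "HOL-Analysis.Analysis"
begin

section \<open>Complex Hilbert spaces\<close>

text \<open>The real scalar multiplication, norm and topology come from the class
  \<^class>\<open>real_normed_vector\<close>; the axioms below tie them to the complex structure. The inner
  product is linear in its second argument.\<close>

class complex_vector = real_vector +
  fixes scaleC :: "complex \<Rightarrow> 'a \<Rightarrow> 'a" (infixr "*\<^sub>C" 75)
  assumes scaleC_add_right: "a *\<^sub>C (x + y) = a *\<^sub>C x + a *\<^sub>C y"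
    and scaleC_add_left: "(a + b) *\<^sub>C x = a *\<^sub>C x + b *\<^sub>C x"
    and scaleC_scaleC: "a *\<^sub>C (b *\<^sub>C x) = (a * b) *\<^sub>C x"
    and scaleC_one: "1 *\<^sub>C x = x"
    and scaleR_scaleC: "r *\<^sub>R x = complex_of_real r *\<^sub>C x"

interpretation complex_vector: vector_space scaleC
  by unfold_locales (simp_all add: scaleC_add_right scaleC_add_left scaleC_scaleC scaleC_one)

class complex_inner = complex_vector + real_normed_vector +
  fixes cinner :: "'a \<Rightarrow> 'a \<Rightarrow> complex" (infix "\<bullet>\<^sub>C" 70)
  assumes cinner_commute: "x \<bullet>\<^sub>C y = cnj (y \<bullet>\<^sub>C x)"
    and cinner_add_right: "x \<bullet>\<^sub>C (y + z) = x \<bullet>\<^sub>C y + x \<bullet>\<^sub>C z"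
    and cinner_scaleC_right: "x \<bullet>\<^sub>C (a *\<^sub>C y) = a * (x \<bullet>\<^sub>C y)"
    and cinner_self: "x \<bullet>\<^sub>C x = complex_of_real ((norm x)\<^sup>2)"

class chilbert_space = complex_inner + complete_space

definition is_onb :: "'a::chilbert_space set \<Rightarrow> bool" where
  "is_onb E \<longleftrightarrow> (\<forall>e\<in>E. norm e = 1) \<and> (\<forall>e\<in>E. \<forall>f\<in>E. e \<noteq> f \<longrightarrow> e \<bullet>\<^sub>C f = 0) \<and>
     closure (complex_vector.span E) = UNIV"

text \<open>An arbitrary orthonormal basis. The trace and the partial trace of a trace class operator do
  not depend on this choice.\<close>

definition some_onb :: "'a::chilbert_space set" where
  "some_onb = (SOME E. is_onb E)"


section \<open>Operators\<close>

definition bounded_clinear :: "('a::complex_inner \<Rightarrow> 'b::complex_inner) \<Rightarrow> bool" where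
  "bounded_clinear A \<longleftrightarrow> bounded_linear A \<and> (\<forall>c x. A (c *\<^sub>C x) = c *\<^sub>C A x)"

definition cadjoint :: "('a::chilbert_space \<Rightarrow> 'b::chilbert_space) \<Rightarrow> 'b \<Rightarrow> 'a" where
  "cadjoint A = (THE B. \<forall>x y. B x \<bullet>\<^sub>C y = x \<bullet>\<^sub>C A y)"

definition unitary_op :: "('a::chilbert_space \<Rightarrow> 'a) \<Rightarrow> bool" where
  "unitary_op U \<longleftrightarrow> bounded_clinear U \<and> cadjoint U \<circ> U = id \<and> U \<circ> cadjoint U = id"

definition orthogonal_projection :: "('a::chilbert_space \<Rightarrow> 'a) \<Rightarrow> bool" where
  "orthogonal_projection Q \<longleftrightarrow> bounded_clinear Q \<and> Q \<circ> Q = Q \<and> cadjoint Q = Q"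

definition positive_op :: "('a::chilbert_space \<Rightarrow> 'a) \<Rightarrow> bool" where
  "positive_op A \<longleftrightarrow> bounded_clinear A \<and> (\<forall>x. x \<bullet>\<^sub>C A x \<in> \<real>\<^sub>\<ge>\<^sub>0)"

text \<open>The absolute value $|A| = (A^*A)^{1/2}$, as the unique positive square root.\<close>

definition abs_op :: "('a::chilbert_space \<Rightarrow> 'a) \<Rightarrow> 'a \<Rightarrow> 'a" where
  "abs_op A = (THE P. positive_op P \<and> P \<circ> P = cadjoint A \<circ> A)"

definition trace_class :: "('a::chilbert_space \<Rightarrow> 'a) \<Rightarrow> bool" where
  "trace_class A \<longleftrightarrow> bounded_clinear A \<and> (\<lambda>e. e \<bullet>\<^sub>C abs_op A e) summable_on some_onb"

definition op_trace :: "('a::chilbert_space \<Rightarrow> 'a) \<Rightarrow> complex" where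
  "op_trace A = (\<Sum>\<^sub>\<infinity>e\<in>some_onb. e \<bullet>\<^sub>C A e)"

definition is_state :: "('a::chilbert_space \<Rightarrow> 'a) \<Rightarrow> bool" where
  "is_state \<tau> \<longleftrightarrow> trace_class \<tau> \<and> positive_op \<tau> \<and> op_trace \<tau> = 1"

text \<open>The rank one operator $|\psi\rangle\langle\phi|$.\<close>

definition ketbra :: "'a::chilbert_space \<Rightarrow> 'a \<Rightarrow> 'a \<Rightarrow> 'a" where
  "ketbra \<psi> \<phi> = (\<lambda>x. (\<phi> \<bullet>\<^sub>C x) *\<^sub>C \<psi>)"


section \<open>Tensor products\<close>

text \<open>A Hilbert space \<open>'t\<close> with a bilinear map \<open>'k \<Rightarrow> 'h \<Rightarrow> 't\<close> is the Hilbert space tensor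
  product of \<open>'k\<close> and \<open>'h\<close>, that is, the completion of the algebraic tensor product, iff inner
  products of elementary tensors factorize and elementary tensors span a dense subspace. This
  determines it up to a unique unitary that respects elementary tensors.\<close>

definition hilbert_tensor ::
    "('k::chilbert_space \<Rightarrow> 'h::chilbert_space \<Rightarrow> 't::chilbert_space) \<Rightarrow> bool" where
  "hilbert_tensor tensor \<longleftrightarrow>
     (\<forall>a a' b. tensor (a + a') b = tensor a b + tensor a' b) \<and>
     (\<forall>a b b'. tensor a (b + b') = tensor a b + tensor a b') \<and>
     (\<forall>c a b. tensor (c *\<^sub>C a) b = c *\<^sub>C tensor a b) \<and>
     (\<forall>c a b. tensor a (c *\<^sub>C b) = c *\<^sub>C tensor a b) \<and>
     (\<forall>a b a' b'. tensor a b \<bullet>\<^sub>C tensor a' b' = (a \<bullet>\<^sub>C a') * (b \<bullet>\<^sub>C b')) \<and>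
     closure (complex_vector.span {tensor a b |a b. True}) = UNIV"

text \<open>The operator $A \otimes B$.\<close>

definition op_tensor ::
    "('k::chilbert_space \<Rightarrow> 'h::chilbert_space \<Rightarrow> 't::chilbert_space)
      \<Rightarrow> ('k \<Rightarrow> 'k) \<Rightarrow> ('h \<Rightarrow> 'h) \<Rightarrow> 't \<Rightarrow> 't" where
  "op_tensor tensor A B =
     (THE C. bounded_clinear C \<and> (\<forall>a b. C (tensor a b) = tensor (A a) (B b)))"

text \<open>The partial trace over the first factor,
  $\sum_e (\langle e| \otimes 1)\, A\, (|e\rangle \otimes 1)$ for an orthonormal basis of \<open>'k\<close>;
  here \<open>tensor e\<close> is the operator $|e\rangle \otimes 1$ from \<open>'h\<close> to \<open>'t\<close>.\<close>

definition partial_trace ::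
    "('k::chilbert_space \<Rightarrow> 'h::chilbert_space \<Rightarrow> 't::chilbert_space)
      \<Rightarrow> ('t \<Rightarrow> 't) \<Rightarrow> 'h \<Rightarrow> 'h" where
  "partial_trace tensor A =
     (\<lambda>y. \<Sum>\<^sub>\<infinity>e\<in>some_onb. cadjoint (tensor e) (A (tensor e y)))"

end

(* Eliminating basis vectors by Schur complements gives tau = sum_n |v_n><v_n| with
   sum_n |v_n|^2 = 1, so that T(|phi><phi|) = sum_n |z_n><z_n| with z_n = U (v_n (x) phi). Writing u_n
   and w_n for the z_n of psi_0 and psi_1, the two trace conditions force (Q (x) 1) u_n = 0 and
   (Q (x) 1) w_n = w_n. Hence (Q (x) 1) T(|psi><psi|) is |alpha_1|^2 T(|psi_1><psi_1|) plus a multiple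
   of the cross term sum_n |w_n><u_n|. Its partial trace vanishes, because the partial trace is cyclic
   with respect to Q (x) 1. The other component is symmetric. *)
theory Submission
  imports Defs
begin

section \<open>Complex inner product spaces\<close>

\<comment> \<open>Any square summable v_n with tau = sum_n |v_n><v_n| will do, orthogonal or not.
  This is why elimination can replace diagonalization: a Schur complement rests only on the
  Cauchy-Schwarz inequality for a positive form, whereas eigenvectors would call for compactness and
  a spectral theorem. The obstacle is convergence. Bases may be uncountable and
  \<open>infsum\<close> is 0 on divergent families, so each exchange of a sum over n with a sum over
  a basis comes with an explicit summable majorant. A single number controls all n because <z_n, Q'
  z_n> = |Q' z_n|^2 is nonnegative, where Q' = Q (x) 1: trace 0 kills every term, and trace 1
  exhausts the total weight sum_n |v_n|^2 = 1. Cyclicity is applied to each n separately: the basis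
  sum for |w_n><u_n| collapses to one expression in g_n = (1 (x) <y|) u_n and w_n, where Q g_n = 0
  but Q' w_n = w_n. Since \<open>cadjoint\<close>, \<open>abs_op\<close> and
  \<open>op_tensor\<close> are definite descriptions, every value that occurs needs existence and
  uniqueness; hence the Riesz theorem and the square root of a rank one operator.\<close>
subclass (in chilbert_space) banach ..

lemma cinner_add_left: "(x + y) \<bullet>\<^sub>C z = x \<bullet>\<^sub>C z + y \<bullet>\<^sub>C (z::'a::complex_inner)"
  by (metis cinner_add_right cinner_commute complex_cnj_add)

lemma cinner_scaleC_left: "(a *\<^sub>C x) \<bullet>\<^sub>C y = cnj a * (x \<bullet>\<^sub>C (y::'a::complex_inner))"
  by (metis cinner_scaleC_right cinner_commute complex_cnj_mult)

lemma cinner_scaleR_right: "x \<bullet>\<^sub>C (r *\<^sub>R y) = r *\<^sub>R (x \<bullet>\<^sub>C (y::'a::complex_inner))"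
  by (simp add: scaleR_scaleC cinner_scaleC_right scaleR_conv_of_real)

lemma cinner_scaleR_left: "(r *\<^sub>R x) \<bullet>\<^sub>C y = r *\<^sub>R (x \<bullet>\<^sub>C (y::'a::complex_inner))"
  by (simp add: scaleR_scaleC cinner_scaleC_left scaleR_conv_of_real)

lemma cinner_zero_right [simp]: "x \<bullet>\<^sub>C 0 = (0::complex)" for x :: "'a::complex_inner"
  using cinner_add_right[of x 0 0] by simp

lemma cinner_zero_left [simp]: "0 \<bullet>\<^sub>C x = (0::complex)" for x :: "'a::complex_inner"
  using cinner_add_left[of 0 0 x] by simp

lemma cinner_minus_right: "x \<bullet>\<^sub>C (- y) = - (x \<bullet>\<^sub>C (y::'a::complex_inner))"
  using cinner_add_right[of x y "-y"] by (simp add: eq_neg_iff_add_eq_0 add.commute)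

lemma cinner_minus_left: "(- x) \<bullet>\<^sub>C y = - (x \<bullet>\<^sub>C (y::'a::complex_inner))"
  using cinner_add_left[of x "-x" y] by (simp add: eq_neg_iff_add_eq_0 add.commute)

lemma cinner_diff_right: "x \<bullet>\<^sub>C (y - z) = x \<bullet>\<^sub>C y - x \<bullet>\<^sub>C (z::'a::complex_inner)"
  using cinner_add_right[of x y "-z"] by (simp add: cinner_minus_right)

lemma cinner_diff_left: "(x - y) \<bullet>\<^sub>C z = x \<bullet>\<^sub>C z - y \<bullet>\<^sub>C (z::'a::complex_inner)"
  using cinner_add_left[of x "-y" z] by (simp add: cinner_minus_left)

lemma cinner_sum_right: "x \<bullet>\<^sub>C (\<Sum>i\<in>F. f i) = (\<Sum>i\<in>F. x \<bullet>\<^sub>C (f i :: 'a::complex_inner))"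
  by (induction F rule: infinite_finite_induct) (auto simp: cinner_add_right)

lemma cinner_sum_left: "(\<Sum>i\<in>F. f i) \<bullet>\<^sub>C x = (\<Sum>i\<in>F. (f i :: 'a::complex_inner) \<bullet>\<^sub>C x)"
  by (induction F rule: infinite_finite_induct) (auto simp: cinner_add_left)

lemmas cinner_simps = cinner_add_left cinner_add_right cinner_diff_left cinner_diff_right
  cinner_scaleC_left cinner_scaleC_right

lemma cinner_eq_zero_iff [simp]: "x \<bullet>\<^sub>C x = 0 \<longleftrightarrow> x = (0::'a::complex_inner)"
  by (simp add: cinner_self)

lemma cinner_ext: "(\<And>z. z \<bullet>\<^sub>C x = z \<bullet>\<^sub>C y) \<Longrightarrow> x = (y::'a::complex_inner)"
  by (metis cinner_diff_right cinner_eq_zero_iff eq_iff_diff_eq_0)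

lemma cinner_ext_left: "(\<And>z. x \<bullet>\<^sub>C z = y \<bullet>\<^sub>C z) \<Longrightarrow> x = (y::'a::complex_inner)"
  by (metis cinner_commute cinner_ext)

text \<open>The normed space axioms give homogeneity for real scalars only; the complex case comes
  from \<open>cinner_self\<close>.\<close>

lemma norm_scaleC [simp]: "norm (c *\<^sub>C x) = cmod c * norm (x::'a::complex_inner)"
proof -
  have "complex_of_real ((norm (c *\<^sub>C x))\<^sup>2) = complex_of_real ((cmod c * norm x)\<^sup>2)"
    unfolding cinner_self[symmetric] cinner_scaleC_left cinner_scaleC_right
    by (simp add: cinner_self power_mult_distrib complex_norm_square mult_ac
        del: of_real_power)
  then have "(norm (c *\<^sub>C x))\<^sup>2 = (cmod c * norm x)\<^sup>2"
    using of_real_eq_iff by blast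
  then show ?thesis by (simp add: power2_eq_iff_nonneg)
qed

lemma scaleC_zero_left [simp]: "0 *\<^sub>C x = (0::'a::complex_vector)"
  using scaleC_add_left[of 0 0 x] by simp

lemma scaleC_zero_right [simp]: "c *\<^sub>C 0 = (0::'a::complex_vector)"
  using scaleC_add_right[of c 0 0] by simp

lemma scaleC_minus_left: "(- c) *\<^sub>C x = - (c *\<^sub>C (x::'a::complex_vector))"
  using scaleC_add_left[of c "-c" x] by (simp add: eq_neg_iff_add_eq_0 add.commute)

lemma scaleC_minus_right: "c *\<^sub>C (- x) = - (c *\<^sub>C (x::'a::complex_vector))"
  using scaleC_add_right[of c x "-x"] by (simp add: eq_neg_iff_add_eq_0 add.commute)

lemma scaleC_diff_right: "c *\<^sub>C (x - y) = c *\<^sub>C x - c *\<^sub>C (y::'a::complex_vector)"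
  using scaleC_add_right[of c x "-y"] by (simp add: scaleC_minus_right)

section \<open>Bounded complex-linear maps and positive operators\<close>

lemma bounded_clinearI:
  assumes "\<And>x y. A (x + y) = A x + A y" "\<And>c x. A (c *\<^sub>C x) = c *\<^sub>C A x"
    and "\<And>x. norm (A x) \<le> norm x * K"
  shows "bounded_clinear A"
  unfolding bounded_clinear_def
  using assms by (auto intro!: bounded_linear_intro[of A K] simp: scaleR_scaleC)

lemma bounded_clinearD:
  assumes "bounded_clinear A"
  shows "bounded_linear A" "A (x + y) = A x + A y" "A (c *\<^sub>C x) = c *\<^sub>C A x"
    "A (x - y) = A x - A y" "A 0 = 0"
  using assms unfolding bounded_clinear_def
  by (auto simp: linear_simps)

lemma bounded_clinear_id: "bounded_clinear id"
  unfolding bounded_clinear_def id_def by (simp add: bounded_linear_ident)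

lemma bounded_clinear_diff:
  assumes "bounded_clinear A" "bounded_clinear B"
  shows "bounded_clinear (\<lambda>x. A x - B x)"
  using assms unfolding bounded_clinear_def
  by (auto simp: scaleC_diff_right intro: bounded_linear_sub)

lemma positive_op_id: "positive_op id"
  unfolding positive_op_def by (auto simp: bounded_clinear_id cinner_self
      complex_nonneg_Reals_iff simp del: of_real_power)

lemma positive_opD:
  assumes "positive_op A"
  shows "bounded_clinear A" "Im (x \<bullet>\<^sub>C A x) = 0" "Re (x \<bullet>\<^sub>C A x) \<ge> 0"
  using assms unfolding positive_op_def complex_nonneg_Reals_iff by auto

text \<open>Polarization of the real quadratic form \<open>\<lambda>x. x \<bullet>\<^sub>C A x\<close>.\<close>

lemma positive_op_selfadjoint:
  assumes "positive_op A"
  shows "x \<bullet>\<^sub>C A y = A x \<bullet>\<^sub>C y"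
proof -
  note A = bounded_clinearD[OF positive_opD(1)[OF assms]]
  note I = positive_opD(2)[OF assms]
  have 1: "Im (x \<bullet>\<^sub>C A y) + Im (y \<bullet>\<^sub>C A x) = 0"
    using I[of "x + y"] I[of x] I[of y] by (simp add: A cinner_simps)
  \<comment> \<open>Replacing y by i y turns the imaginary part of the cross terms into the real
    part.\<close>
  have 2: "Re (x \<bullet>\<^sub>C A y) - Re (y \<bullet>\<^sub>C A x) = 0"
    using I[of "x + \<i> *\<^sub>C y"] I[of x] I[of y] by (simp add: A cinner_simps)
  have "x \<bullet>\<^sub>C A y = cnj (y \<bullet>\<^sub>C A x)"
    using 1 2 by (simp add: complex_eq_iff)
  then show ?thesis by (metis cinner_commute)
qed

text \<open>Discriminant argument for the form <x, A y>. The form may be degenerate, so <y, A y> = 0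
  is a separate case.\<close>

lemma positive_op_Cauchy_Schwarz:
  assumes "positive_op A"
  shows "(cmod (y \<bullet>\<^sub>C A x))\<^sup>2 \<le> Re (x \<bullet>\<^sub>C A x) * Re (y \<bullet>\<^sub>C A y)"
proof -
  note A = bounded_clinearD[OF positive_opD(1)[OF assms]]
  define a b p where "a = y \<bullet>\<^sub>C A x" and "b = Re (y \<bullet>\<^sub>C A y)" and "p = Re (x \<bullet>\<^sub>C A x)"
  have yAy: "y \<bullet>\<^sub>C A y = complex_of_real b"
    using positive_opD(2)[OF assms] by (simp add: b_def complex_eq_iff)
  have xAy: "x \<bullet>\<^sub>C A y = cnj a"
    unfolding a_def by (metis cinner_commute positive_op_selfadjoint[OF assms])
  \<comment> \<open>Moving by t = s a, with a the cross term itself, aligns the phases and leaves a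
    real quadratic polynomial in s.\<close>
  have *: "0 \<le> p - 2 * s * (cmod a)\<^sup>2 + s\<^sup>2 * (cmod a)\<^sup>2 * b" for s :: real
  proof -
    define t where "t = complex_of_real s * a"
    have "0 \<le> Re ((x - t *\<^sub>C y) \<bullet>\<^sub>C A (x - t *\<^sub>C y))"
      by (rule positive_opD[OF assms])
    also have "(x - t *\<^sub>C y) \<bullet>\<^sub>C A (x - t *\<^sub>C y)
        = x \<bullet>\<^sub>C A x - t * cnj a - cnj t * a + cnj t * t * complex_of_real b"
      by (simp add: A cinner_simps yAy xAy flip: a_def) (simp add: algebra_simps)
    also have "Re \<dots> = p - 2 * s * (cmod a)\<^sup>2 + s\<^sup>2 * (cmod a)\<^sup>2 * b"
      unfolding t_def p_def cmod_power2 by (simp add: algebra_simps power2_eq_square)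
    finally show ?thesis .
  qed
  have b0: "b \<ge> 0" unfolding b_def by (rule positive_opD[OF assms])
  have "(cmod a)\<^sup>2 \<le> p * b"
  proof (cases "b = 0")
    case True
    have "a = 0"
    proof (rule ccontr)
      assume "a \<noteq> 0"
      \<comment> \<open>With b = 0 the bound is linear in s, and this s makes it equal to
        -1.\<close>
      then have "0 \<le> p - (p + 1)"
        using *[of "(p + 1) / (2 * (cmod a)\<^sup>2)"] True by simp
      then show False by simp
    qed
    then show ?thesis using True by simp
  next
    case False
    \<comment> \<open>s = 1/b minimizes the quadratic.\<close>
    then have "0 \<le> p - (cmod a)\<^sup>2 / b"
      using *[of "1 / b"] by (simp add: power2_eq_square)
    then show ?thesis using False b0 by (simp add: field_simps)
  qed
  then show ?thesis unfolding a_def b_def p_def .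
qed

text \<open>Cauchy-Schwarz paired with the vector A x bounds |A x|^4 by 0.\<close>

lemma positive_op_zero:
  assumes "positive_op A" "x \<bullet>\<^sub>C A x = 0"
  shows "A x = 0"
  using positive_op_Cauchy_Schwarz[OF assms(1), of "A x" x] assms(2) by simp

lemma Cauchy_Schwarz_cinner: "cmod (x \<bullet>\<^sub>C y) \<le> norm x * norm (y::'a::chilbert_space)"
proof -
  have "(cmod (x \<bullet>\<^sub>C y))\<^sup>2 \<le> (norm x * norm y)\<^sup>2"
    using positive_op_Cauchy_Schwarz[OF positive_op_id, of x y]
    by (simp add: cinner_self power_mult_distrib mult.commute del: of_real_power)
  then show ?thesis by (rule power2_le_imp_le) simp
qed

lemma bounded_bilinear_cinner:
  "bounded_bilinear (\<lambda>x y. x \<bullet>\<^sub>C (y::'a::chilbert_space))"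
  by standard (auto simp: cinner_simps cinner_scaleR_left cinner_scaleR_right
      intro!: exI[of _ 1] Cauchy_Schwarz_cinner)

lemma bounded_bilinear_scaleC:
  "bounded_bilinear (\<lambda>c x. c *\<^sub>C (x::'a::complex_inner))"
  by standard (auto simp: scaleC_add_left scaleC_add_right scaleC_scaleC scaleR_scaleC
      scaleR_conv_of_real mult.commute intro!: exI[of _ 1])

lemmas bounded_linear_cinner_right = bounded_bilinear.bounded_linear_right[OF bounded_bilinear_cinner]
lemmas bounded_linear_cinner_left = bounded_bilinear.bounded_linear_left[OF bounded_bilinear_cinner]
lemmas bounded_linear_scaleC_right = bounded_bilinear.bounded_linear_right[OF bounded_bilinear_scaleC]

lemma norm_add_square:
  "(norm (x + y))\<^sup>2 = (norm x)\<^sup>2 + 2 * Re (x \<bullet>\<^sub>C y) + (norm (y::'a::complex_inner))\<^sup>2"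
proof -
  have "complex_of_real ((norm (x + y))\<^sup>2) = x \<bullet>\<^sub>C x + (x \<bullet>\<^sub>C y + cnj (x \<bullet>\<^sub>C y)) + y \<bullet>\<^sub>C y"
    unfolding cinner_self[symmetric] cinner_commute[of x y, symmetric]
    by (simp add: cinner_simps) (metis cinner_commute)
  then show ?thesis
    by (simp add: cinner_self complex_eq_iff complex_add_cnj del: of_real_power)
qed

lemma norm_diff_square:
  "(norm (x - y))\<^sup>2 = (norm x)\<^sup>2 - 2 * Re (x \<bullet>\<^sub>C y) + (norm (y::'a::complex_inner))\<^sup>2"
  using norm_add_square[of x "-y"] by (simp add: cinner_minus_right)

lemma parallelogram_law:
  "(norm (x + y))\<^sup>2 + (norm (x - y))\<^sup>2 = 2 * (norm x)\<^sup>2 + 2 * (norm (y::'a::complex_inner))\<^sup>2"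
  by (simp add: norm_add_square norm_diff_square)

section \<open>Closed spans and density arguments\<close>

lemma closed_subspace_closure_span:
  fixes S :: "'a::complex_inner set"
  shows "x \<in> closure (complex_vector.span S) \<Longrightarrow> y \<in> closure (complex_vector.span S) \<Longrightarrow>
      x + y \<in> closure (complex_vector.span S)"
    and "x \<in> closure (complex_vector.span S) \<Longrightarrow> c *\<^sub>C x \<in> closure (complex_vector.span S)"
proof -
  assume "x \<in> closure (complex_vector.span S)" "y \<in> closure (complex_vector.span S)"
  then obtain f g where "f \<longlonglongrightarrow> x" "g \<longlonglongrightarrow> y" "\<And>n. f n \<in> complex_vector.span S"
    "\<And>n. g n \<in> complex_vector.span S"
    unfolding closure_sequential by metis
  then have "(\<lambda>n. f n + g n) \<longlonglongrightarrow> x + y" "\<And>n. f n + g n \<in> complex_vector.span S"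
    by (auto intro: tendsto_add complex_vector.span_add)
  then show "x + y \<in> closure (complex_vector.span S)"
    unfolding closure_sequential by (intro exI[of _ "\<lambda>n. f n + g n"]) auto
next
  assume "x \<in> closure (complex_vector.span S)"
  then obtain f where "f \<longlonglongrightarrow> x" "\<And>n. f n \<in> complex_vector.span S"
    unfolding closure_sequential by metis
  then have "(\<lambda>n. c *\<^sub>C f n) \<longlonglongrightarrow> c *\<^sub>C x" "\<And>n. c *\<^sub>C f n \<in> complex_vector.span S"
    by (auto intro: bounded_linear.tendsto[OF bounded_linear_scaleC_right]
        complex_vector.span_scale)
  then show "c *\<^sub>C x \<in> closure (complex_vector.span S)"
    unfolding closure_sequential by (intro exI[of _ "\<lambda>n. c *\<^sub>C f n"]) auto
qed

text \<open>The span is reached by linearity; a closed set containing it then contains its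
  closure.\<close>

lemma closure_span_induct [consumes 1, case_names closed base zero add scale]:
  fixes S :: "'a::complex_inner set"
  assumes "x \<in> closure (complex_vector.span S)"
    and "closed (Collect P)" "\<And>x. x \<in> S \<Longrightarrow> P x" "P 0"
    and "\<And>x y. P x \<Longrightarrow> P y \<Longrightarrow> P (x + y)" "\<And>c x. P x \<Longrightarrow> P (c *\<^sub>C x)"
  shows "P x"
proof -
  have "P y" if "y \<in> complex_vector.span S" for y
    using that
    by (induction rule: complex_vector.span_induct_alt) (auto intro: assms)
  then have "closure (complex_vector.span S) \<subseteq> Collect P"
    by (intro closure_minimal assms) auto
  then show ?thesis using assms(1) by auto
qed

lemma closed_orthogonal: "closed {x. x \<bullet>\<^sub>C z = 0}" for z :: "'a::chilbert_space"
  by (intro closed_Collect_eq continuous_on_const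
      linear_continuous_on[OF bounded_linear_cinner_left])

lemma orthogonal_closure_span:
  fixes S :: "'a::chilbert_space set"
  assumes "x \<in> closure (complex_vector.span S)" "\<And>s. s \<in> S \<Longrightarrow> s \<bullet>\<^sub>C z = 0"
  shows "x \<bullet>\<^sub>C z = 0"
  using assms(1)
  by (induction rule: closure_span_induct)
    (auto simp: assms(2) closed_orthogonal cinner_simps)

section \<open>Projections, adjoints and orthonormal bases\<close>

text \<open>The parallelogram law makes a minimizing sequence for the distance Cauchy. At its limit
  no move along z shortens the residual, which forces orthogonality.\<close>

lemma projection_exists:
  fixes x :: "'a::chilbert_space"
  obtains y where "y \<in> closure (complex_vector.span S)"
    and "\<And>z. z \<in> closure (complex_vector.span S) \<Longrightarrow> z \<bullet>\<^sub>C (x - y) = 0"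
proof -
  define C where "C = closure (complex_vector.span S)"
  define d where "d = infdist x C"
  have add: "a + b \<in> C" if "a \<in> C" "b \<in> C" for a b
    using that unfolding C_def by (rule closed_subspace_closure_span)
  have scale: "c *\<^sub>C a \<in> C" if "a \<in> C" for a c
    using that unfolding C_def by (rule closed_subspace_closure_span)
  have ne: "C \<noteq> {}" and cl: "closed C"
    unfolding C_def using complex_vector.span_zero closure_subset by auto
  have d: "d \<le> norm (x - a)" if "a \<in> C" for a
    using infdist_le[OF that, of x] unfolding d_def by (simp add: dist_norm)
  have d0: "d \<ge> 0" unfolding d_def by (rule infdist_nonneg)
  have "\<exists>a\<in>C. norm (x - a) < d + inverse (real (Suc n))" for n
  proof -
    have "(INF a\<in>C. dist x a) < d + inverse (real (Suc n))"
      using ne unfolding d_def by (simp add: infdist_notempty)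
    then show ?thesis
      using cInf_lessD[of "dist x ` C"] ne by (auto simp: dist_norm)
  qed
  then obtain y where y: "\<And>n. y n \<in> C"
    and yd: "\<And>n. norm (x - y n) < d + inverse (real (Suc n))"
    by metis
  \<comment> \<open>With eps = 1/(N+1), the bound is 4 (d + eps)^2 - 4 d^2: the midpoint of y m and
    y n also lies in C, so it has distance at least d from x.\<close>
  have close: "(norm (y m - y n))\<^sup>2 \<le> 8 * d * inverse (real (Suc N)) + 4 * (inverse (real (Suc N)))\<^sup>2"
    if "m \<ge> N" "n \<ge> N" for m n N
  proof -
    have sq: "(norm (x - y k))\<^sup>2 \<le> (d + inverse (real (Suc N)))\<^sup>2" if "k \<ge> N" for k
    proof (rule power_mono)
      have "inverse (real (Suc k)) \<le> inverse (real (Suc N))"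
        using that by (intro le_imp_inverse_le) auto
      then show "norm (x - y k) \<le> d + inverse (real (Suc N))" using yd[of k] by linarith
    qed simp
    have "(1/2) *\<^sub>C (y m + y n) \<in> C" by (intro scale add y)
    then have "d \<le> norm (x - (1/2) *\<^sub>C (y m + y n))" by (rule d)
    also have "\<dots> = norm ((x - y m) + (x - y n)) / 2"
    proof -
      have half: "(1/2) *\<^sub>C v = (1/2) *\<^sub>R v" for v :: 'a by (simp add: scaleR_scaleC)
      have "x - (1/2) *\<^sub>C (y m + y n) = (1/2) *\<^sub>R ((x - y m) + (x - y n))"
        unfolding half by (simp add: algebra_simps flip: scaleR_add_left)
      then show ?thesis by simp
    qed
    finally have "4 * d\<^sup>2 \<le> (norm ((x - y m) + (x - y n)))\<^sup>2"
      using d0 power_mono[of "2 * d" "norm ((x - y m) + (x - y n))" 2]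
      by (simp add: power_mult_distrib)
    moreover have "norm ((x - y m) - (x - y n)) = norm (y m - y n)"
      by (simp add: norm_minus_commute)
    ultimately show ?thesis
      using parallelogram_law[of "x - y m" "x - y n"] sq[OF that(1)] sq[OF that(2)]
      by (simp add: power2_sum algebra_simps)
  qed
  have "Cauchy y"
  proof (rule metric_CauchyI)
    fix e :: real assume "e > 0"
    have "(\<lambda>N. 8 * d * inverse (real (Suc N)) + 4 * (inverse (real (Suc N)))\<^sup>2)
        \<longlonglongrightarrow> 8 * d * 0 + 4 * 0\<^sup>2"
      by (intro tendsto_intros LIMSEQ_inverse_real_of_nat)
    then have "\<forall>\<^sub>F N in sequentially.
        8 * d * inverse (real (Suc N)) + 4 * (inverse (real (Suc N)))\<^sup>2 < e\<^sup>2"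
      by (rule order_tendstoD) (use \<open>e > 0\<close> in simp)
    then obtain N where N: "8 * d * inverse (real (Suc N)) + 4 * (inverse (real (Suc N)))\<^sup>2 < e\<^sup>2"
      unfolding eventually_sequentially by blast
    have "dist (y m) (y n) < e" if "m \<ge> N" "n \<ge> N" for m n
    proof -
      have "(norm (y m - y n))\<^sup>2 < e\<^sup>2" using close[OF that] N by linarith
      then show ?thesis
        using \<open>e > 0\<close> by (simp add: dist_norm power2_less_imp_less)
    qed
    then show "\<exists>M. \<forall>m\<ge>M. \<forall>n\<ge>M. dist (y m) (y n) < e" by blast
  qed
  then obtain p where lim: "y \<longlonglongrightarrow> p"
    using Cauchy_convergent convergent_def by blast
  have pC: "p \<in> C" using cl y lim by (rule closed_sequentially)
  have "(\<lambda>n. norm (x - y n)) \<longlonglongrightarrow> norm (x - p)"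
    by (intro tendsto_intros lim)
  moreover have "(\<lambda>n. d + inverse (real (Suc n))) \<longlonglongrightarrow> d + 0"
    by (intro tendsto_intros LIMSEQ_inverse_real_of_nat)
  ultimately have "norm (x - p) \<le> d + 0"
    by (rule LIMSEQ_le) (use yd in \<open>auto intro: less_imp_le\<close>)
  then have min: "norm (x - p) \<le> norm (x - a)" if "a \<in> C" for a
    using d[OF that] by simp
  have "z \<bullet>\<^sub>C (x - p) = 0" if "z \<in> C" for z
  proof (rule ccontr)
    assume "z \<bullet>\<^sub>C (x - p) \<noteq> 0"
    define r a where "r = x - p" and "a = z \<bullet>\<^sub>C r"
    have a0: "a \<noteq> 0" using \<open>z \<bullet>\<^sub>C (x - p) \<noteq> 0\<close> unfolding a_def r_def .
    \<comment> \<open>Step length with s |z|^2 < 2, so that the first order gain 2 s |a|^2 exceeds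
      the second order loss s^2 |a|^2 |z|^2; the 1 in the denominator covers every z.\<close>
    define s where "s = 1 / (1 + (norm z)\<^sup>2)"
    have s: "s > 0" "s * (norm z)\<^sup>2 \<le> 1" unfolding s_def
      by (auto simp: field_simps add_pos_nonneg)
    have "norm r \<le> norm (x - (p + (complex_of_real s * a) *\<^sub>C z))"
      unfolding r_def by (intro min add scale pC that)
    also have "x - (p + (complex_of_real s * a) *\<^sub>C z) = r - (complex_of_real s * a) *\<^sub>C z"
      unfolding r_def by simp
    finally have "(norm r)\<^sup>2 \<le> (norm (r - (complex_of_real s * a) *\<^sub>C z))\<^sup>2"
      by (simp add: power_mono)
    also have "\<dots> = (norm r)\<^sup>2 - 2 * Re (complex_of_real s * a * cnj a) + (s * cmod a * norm z)\<^sup>2"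
      unfolding norm_diff_square cinner_scaleC_right a_def
      using s(1) by (simp add: cinner_commute[of r z] norm_mult)
    also have "Re (complex_of_real s * a * cnj a) = s * (cmod a)\<^sup>2"
      by (simp add: mult.assoc flip: complex_norm_square)
    finally have "0 \<le> s * (cmod a)\<^sup>2 * (s * (norm z)\<^sup>2 - 2)"
      by (simp add: power_mult_distrib algebra_simps power2_eq_square)
    moreover have "s * (cmod a)\<^sup>2 > 0" using s a0 by simp
    ultimately show False using s(2) by (simp add: zero_le_mult_iff)
  qed
  then show ?thesis using that pC unfolding C_def by blast
qed

text \<open>The kernel has codimension one: for r orthogonal to it with f r nonzero, x - (f x / f r)
  r lies in the kernel, and pairing this with r determines f x.\<close>

lemma riesz_representation:
  fixes f :: "'a::chilbert_space \<Rightarrow> complex"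
  assumes "bounded_linear f" "\<And>c x. f (c *\<^sub>C x) = c * f x"
  obtains g where "\<And>x. f x = g \<bullet>\<^sub>C x"
proof (cases "\<forall>x. f x = 0")
  case True
  then show ?thesis using that[of 0] by simp
next
  case False
  then obtain x0 where x0: "f x0 \<noteq> 0" by blast
  note f = linear_simps[OF assms(1)] assms(2)
  have cl: "closed {x. f x = 0}"
    by (intro closed_Collect_eq continuous_on_const linear_continuous_on[OF assms(1)])
  \<comment> \<open>The kernel is already a closed subspace; this is the shape in which projections
    are available.\<close>
  define C where "C = closure (complex_vector.span {x. f x = 0})"
  have C: "f x = 0" if "x \<in> C" for x
    using that unfolding C_def
    by (induction rule: closure_span_induct) (auto simp: f cl)
  obtain y where y: "y \<in> C" "\<And>z. z \<in> C \<Longrightarrow> z \<bullet>\<^sub>C (x0 - y) = 0"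
    using projection_exists[of "{x. f x = 0}" x0] unfolding C_def by blast
  define r where "r = x0 - y"
  have fr: "f r \<noteq> 0" using x0 C[OF y(1)] by (simp add: r_def f)
  then have r0: "r \<noteq> 0" using f by auto
  have "f x = (cnj (f r / complex_of_real ((norm r)\<^sup>2)) *\<^sub>C r) \<bullet>\<^sub>C x" for x
  proof -
    have "x - (f x / f r) *\<^sub>C r \<in> C"
      unfolding C_def using fr
      by (intro subsetD[OF closure_subset] complex_vector.span_base) (simp add: f)
    then have "(x - (f x / f r) *\<^sub>C r) \<bullet>\<^sub>C r = 0" unfolding r_def by (rule y)
    then have "r \<bullet>\<^sub>C (x - (f x / f r) *\<^sub>C r) = 0" by (metis cinner_commute complex_cnj_zero)
    then have "r \<bullet>\<^sub>C x = f x / f r * complex_of_real ((norm r)\<^sup>2)"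
      by (simp add: cinner_simps cinner_self)
    then show ?thesis using fr r0 by (simp add: cinner_scaleC_left field_simps)
  qed
  then show ?thesis by (rule that)
qed

section \<open>Adjoints\<close>

lemma cadjoint_eqI:
  assumes "\<And>x y. B x \<bullet>\<^sub>C y = x \<bullet>\<^sub>C A y"
  shows "cadjoint A = B"
  unfolding cadjoint_def
proof (rule the_equality)
  fix B' assume "\<forall>x y. B' x \<bullet>\<^sub>C y = x \<bullet>\<^sub>C A y"
  then show "B' = B" using assms by (intro ext cinner_ext_left) simp
qed (use assms in blast)

text \<open>Existence of the adjoint: Riesz applied to y |-> <x, A y> for each x.\<close>

lemma cinner_cadjoint_left:
  assumes "bounded_clinear A"
  shows "cadjoint A x \<bullet>\<^sub>C y = x \<bullet>\<^sub>C A y"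
proof -
  have "\<exists>g. \<forall>y. x \<bullet>\<^sub>C A y = g \<bullet>\<^sub>C y" for x
  proof -
    have "bounded_linear (\<lambda>y. x \<bullet>\<^sub>C A y)"
      by (intro bounded_linear_compose[OF bounded_linear_cinner_right] bounded_clinearD[OF assms])
    then show ?thesis
      by (rule riesz_representation[of "\<lambda>y. x \<bullet>\<^sub>C A y"])
        (auto simp: bounded_clinearD[OF assms] cinner_simps)
  qed
  then obtain B where "\<And>x y. B x \<bullet>\<^sub>C y = x \<bullet>\<^sub>C A y" by metis
  then show ?thesis using cadjoint_eqI by metis
qed

lemma cinner_cadjoint_right:
  "bounded_clinear A \<Longrightarrow> y \<bullet>\<^sub>C cadjoint A x = A y \<bullet>\<^sub>C x"
  using cinner_cadjoint_left[of A x y] by (simp add: cinner_commute[of y] cinner_commute[of "A y"])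

text \<open>With A' the adjoint, |A' x|^2 = <x, A (A' x)> is at most |x| K |A' x|; cancel one
  factor.\<close>

lemma norm_cadjoint_le:
  assumes "bounded_clinear A" and K: "\<And>x. norm (A x) \<le> norm x * K" "K \<ge> 0"
  shows "norm (cadjoint A x) \<le> norm x * K"
proof -
  have "complex_of_real ((norm (cadjoint A x))\<^sup>2) = x \<bullet>\<^sub>C A (cadjoint A x)"
    unfolding cinner_self[symmetric] by (rule cinner_cadjoint_left[OF assms(1)])
  then have "(norm (cadjoint A x))\<^sup>2 = cmod (x \<bullet>\<^sub>C A (cadjoint A x))"
    by (metis norm_of_real abs_power2)
  also have "\<dots> \<le> norm x * norm (A (cadjoint A x))" by (rule Cauchy_Schwarz_cinner)
  also have "\<dots> \<le> norm x * (norm (cadjoint A x) * K)"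
    by (intro mult_left_mono K) simp
  finally have "norm (cadjoint A x) * norm (cadjoint A x) \<le> norm (cadjoint A x) * (norm x * K)"
    by (simp add: power2_eq_square mult_ac)
  then show ?thesis
    using K(2) by (cases "norm (cadjoint A x) = 0") (auto simp: mult_le_cancel_left)
qed

lemma bounded_clinear_cadjoint:
  assumes "bounded_clinear A"
  shows "bounded_clinear (cadjoint A)"
proof -
  obtain K where K: "\<And>x. norm (A x) \<le> norm x * K" "K \<ge> 0"
    using bounded_linear.nonneg_bounded[OF bounded_clinearD(1)[OF assms]] by metis
  show ?thesis
  proof (rule bounded_clinearI)
    fix x y
    show "cadjoint A (x + y) = cadjoint A x + cadjoint A y"
      by (rule cinner_ext_left) (simp add: cinner_cadjoint_left[OF assms] cinner_simps)
  next
    fix c x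
    show "cadjoint A (c *\<^sub>C x) = c *\<^sub>C cadjoint A x"
      by (rule cinner_ext_left) (simp add: cinner_cadjoint_left[OF assms] cinner_simps)
  next
    fix x
    show "norm (cadjoint A x) \<le> norm x * K"
      by (rule norm_cadjoint_le[OF assms K])
  qed
qed

section \<open>Orthonormal bases and Fourier expansions\<close>

lemma is_onbD:
  assumes "is_onb E"
  shows "e \<in> E \<Longrightarrow> norm e = 1" "e \<in> E \<Longrightarrow> e \<bullet>\<^sub>C e = 1"
    "e \<in> E \<Longrightarrow> f \<in> E \<Longrightarrow> e \<noteq> f \<Longrightarrow> e \<bullet>\<^sub>C f = 0"
    "closure (complex_vector.span E) = UNIV"
  using assms unfolding is_onb_def by (auto simp: cinner_self)

text \<open>Justifies the choice in \<open>some_onb\<close>. Zorn yields a maximal orthonormal set;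
  a vector outside its closed span would leave a normalized residual by which the set could be
  enlarged.\<close>

lemma is_onb_some_onb: "is_onb (some_onb :: 'a::chilbert_space set)"
proof -
  define \<A> :: "'a set set" where
    "\<A> = {E. (\<forall>e\<in>E. norm e = 1) \<and> (\<forall>e\<in>E. \<forall>f\<in>E. e \<noteq> f \<longrightarrow> e \<bullet>\<^sub>C f = 0)}"
  have "\<exists>M\<in>\<A>. \<forall>X\<in>\<A>. M \<subseteq> X \<longrightarrow> X = M"
  proof (rule subset_Zorn')
    fix C assume C: "subset.chain \<A> C"
    then have sub: "C \<subseteq> \<A>" and tot: "\<And>X Y. X \<in> C \<Longrightarrow> Y \<in> C \<Longrightarrow> X \<subseteq> Y \<or> Y \<subseteq> X"
      by (auto simp: subset_chain_def)
    show "\<Union> C \<in> \<A>"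
      unfolding \<A>_def
    proof (safe)
      fix e X assume "e \<in> X" "X \<in> C"
      then show "norm e = 1" using sub unfolding \<A>_def by blast
    next
      fix e X f Y assume *: "e \<in> X" "X \<in> C" "f \<in> Y" "Y \<in> C" "e \<noteq> f"
      then obtain Z where "Z \<in> C" "e \<in> Z" "f \<in> Z" using tot[of X Y] by blast
      then show "e \<bullet>\<^sub>C f = 0" using sub * unfolding \<A>_def by blast
    qed
  qed
  then obtain M where M: "M \<in> \<A>" "\<And>X. X \<in> \<A> \<Longrightarrow> M \<subseteq> X \<Longrightarrow> X = M" by blast
  have "closure (complex_vector.span M) = UNIV"
  proof (rule ccontr)
    assume "closure (complex_vector.span M) \<noteq> UNIV"
    then obtain x where x: "x \<notin> closure (complex_vector.span M)" by blast
    obtain y where y: "y \<in> closure (complex_vector.span M)"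
      "\<And>z. z \<in> closure (complex_vector.span M) \<Longrightarrow> z \<bullet>\<^sub>C (x - y) = 0"
      by (rule projection_exists[where S = M and x = x]) blast
    have "x - y \<noteq> 0" using x y(1) by auto
    define u where "u = complex_of_real (inverse (norm (x - y))) *\<^sub>C (x - y)"
    have u1: "norm u = 1" using \<open>x - y \<noteq> 0\<close> unfolding u_def by (simp add: norm_inverse)
    have perp: "e \<bullet>\<^sub>C u = 0" if "e \<in> M" for e
    proof -
      have "e \<in> closure (complex_vector.span M)"
        using that closure_subset complex_vector.span_base by blast
      then show ?thesis using y(2) unfolding u_def by (simp add: cinner_scaleC_right)
    qed
    have perp': "u \<bullet>\<^sub>C e = 0" if "e \<in> M" for e
      using perp[OF that] by (metis cinner_commute complex_cnj_zero)
    have "insert u M \<in> \<A>"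
      using M(1) u1 perp perp' unfolding \<A>_def by auto
    then have "u \<in> M" using M(2) by blast
    then have "u = 0" using perp by fastforce
    then show False using u1 by simp
  qed
  then have "is_onb M" using M(1) unfolding is_onb_def \<A>_def by blast
  then show ?thesis unfolding some_onb_def by (rule someI)
qed

lemma onb_residual_orthogonal:
  assumes "is_onb E" "F \<subseteq> E" "finite F" "s \<in> complex_vector.span F"
  shows "s \<bullet>\<^sub>C (x - (\<Sum>e\<in>F. (e \<bullet>\<^sub>C x) *\<^sub>C e)) = 0"
proof (rule orthogonal_closure_span)
  show "s \<in> closure (complex_vector.span F)" using assms(4) closure_subset by blast
  fix f assume f: "f \<in> F"
  have "(\<Sum>e\<in>F. (e \<bullet>\<^sub>C x) * (f \<bullet>\<^sub>C e)) = (\<Sum>e\<in>F. if e = f then f \<bullet>\<^sub>C x else 0)"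
    using f assms by (intro sum.cong) (auto simp: is_onbD[OF assms(1)] subset_iff)
  then show "f \<bullet>\<^sub>C (x - (\<Sum>e\<in>F. (e \<bullet>\<^sub>C x) *\<^sub>C e)) = 0"
    using f assms(3) by (simp add: cinner_simps cinner_sum_right)
qed

text \<open>The Fourier sum p over F is the projection onto the span, so x - p is orthogonal to p -
  s and Pythagoras applies.\<close>

lemma onb_best_approximation:
  assumes "is_onb E" "F \<subseteq> E" "finite F" "s \<in> complex_vector.span F"
  shows "norm (x - (\<Sum>e\<in>F. (e \<bullet>\<^sub>C x) *\<^sub>C e)) \<le> norm (x - s)"
proof -
  define p where "p = (\<Sum>e\<in>F. (e \<bullet>\<^sub>C x) *\<^sub>C e)"
  have "p \<in> complex_vector.span F" unfolding p_def
    by (intro complex_vector.span_sum complex_vector.span_scale complex_vector.span_base)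
  then have "p - s \<in> complex_vector.span F"
    using assms(4) by (rule complex_vector.span_diff)
  then have "(p - s) \<bullet>\<^sub>C (x - p) = 0"
    unfolding p_def by (rule onb_residual_orthogonal[OF assms(1-3)])
  then have "(norm ((p - s) + (x - p)))\<^sup>2 = (norm (p - s))\<^sup>2 + (norm (x - p))\<^sup>2"
    using norm_add_square[of "p - s" "x - p"] by simp
  then have "(norm (x - p))\<^sup>2 \<le> (norm (x - s))\<^sup>2" by simp
  then show ?thesis unfolding p_def by (rule power2_le_imp_le) simp
qed

text \<open>An approximant from the span of a finite F remains available for every larger finite G,
  and the Fourier sum over G does at least as well. This is convergence along finite subsets, so E
  may be uncountable.\<close>

lemma onb_expansion:
  fixes x :: "'a::chilbert_space"
  assumes "is_onb E"
  shows "((\<lambda>e. (e \<bullet>\<^sub>C x) *\<^sub>C e) has_sum x) E"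
  unfolding has_sum_def
proof (rule tendstoI)
  fix \<epsilon> :: real assume "\<epsilon> > 0"
  have "x \<in> closure (complex_vector.span E)" using is_onbD(4)[OF assms] by simp
  then obtain s where s: "s \<in> complex_vector.span E" "dist s x < \<epsilon>"
    using \<open>\<epsilon> > 0\<close> unfolding closure_approachable by blast
  then obtain F c where F: "finite F" "F \<subseteq> E" "s = (\<Sum>a\<in>F. c a *\<^sub>C a)"
    unfolding complex_vector.span_explicit by blast
  show "\<forall>\<^sub>F G in finite_subsets_at_top E. dist (\<Sum>e\<in>G. (e \<bullet>\<^sub>C x) *\<^sub>C e) x < \<epsilon>"
    unfolding eventually_finite_subsets_at_top
  proof (intro exI[of _ F] conjI F allI impI)
    fix G assume G: "finite G \<and> F \<subseteq> G \<and> G \<subseteq> E"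
    have "s \<in> complex_vector.span G"
      unfolding F(3) using G
      by (intro complex_vector.span_sum complex_vector.span_scale complex_vector.span_base) auto
    then have "norm (x - (\<Sum>e\<in>G. (e \<bullet>\<^sub>C x) *\<^sub>C e)) \<le> norm (x - s)"
      using G by (intro onb_best_approximation[OF assms]) auto
    then show "dist (\<Sum>e\<in>G. (e \<bullet>\<^sub>C x) *\<^sub>C e) x < \<epsilon>"
      using s(2) by (simp add: dist_norm norm_minus_commute)
  qed
qed

lemma parseval:
  fixes x :: "'a::chilbert_space"
  assumes "is_onb E"
  shows "((\<lambda>e. (x \<bullet>\<^sub>C e) * (e \<bullet>\<^sub>C y)) has_sum x \<bullet>\<^sub>C y) E"
  using has_sum_bounded_linear[OF bounded_linear_cinner_right onb_expansion[OF assms, of y], of x]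
  by (simp add: o_def cinner_scaleC_right mult.commute)

lemma cinner_mult_commute: "(x \<bullet>\<^sub>C y) * (y \<bullet>\<^sub>C x) = complex_of_real ((cmod (x \<bullet>\<^sub>C y))\<^sup>2)"
  by (metis cinner_commute complex_norm_square)

lemma cmod_cinner_commute: "cmod (x \<bullet>\<^sub>C y) = cmod (y \<bullet>\<^sub>C x)"
  by (metis cinner_commute complex_mod_cnj)

lemma parseval_norm:
  fixes x :: "'a::chilbert_space"
  assumes "is_onb E"
  shows "((\<lambda>e. (cmod (x \<bullet>\<^sub>C e))\<^sup>2) has_sum (norm x)\<^sup>2) E"
  using has_sum_Re[OF parseval[OF assms, of x x]]
  by (simp only: cinner_mult_commute cinner_self Re_complex_of_real)

lemma bessel:
  fixes x :: "'a::chilbert_space"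
  assumes "is_onb E" "F \<subseteq> E" "finite F"
  shows "(\<Sum>e\<in>F. (cmod (x \<bullet>\<^sub>C e))\<^sup>2) \<le> (norm x)\<^sup>2"
  by (rule finite_sum_le_has_sum[OF parseval_norm[OF assms(1)]]) (use assms(2,3) in auto)

section \<open>Sums of rank one operators\<close>

text \<open>Fubini: the summable bound b on absolute row sums makes the double family absolutely
  summable. A common T for two \<open>has_sum\<close> facts also delivers convergence of both outer
  sums, which an equation between \<open>infsum\<close> values would not.\<close>

lemma has_sum_iterated_swap:
  fixes S :: "'e \<Rightarrow> 'n \<Rightarrow> 'b::banach"
  assumes bound: "\<And>n F. n \<in> N \<Longrightarrow> finite F \<Longrightarrow> F \<subseteq> A \<Longrightarrow> (\<Sum>e\<in>F. norm (S e n)) \<le> b n"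
    and b: "b summable_on N"
    and L: "\<And>n. n \<in> N \<Longrightarrow> ((\<lambda>e. S e n) has_sum L n) A"
    and R: "\<And>e. e \<in> A \<Longrightarrow> (S e has_sum R e) N"
  obtains T where "(L has_sum T) N" "(R has_sum T) A"
proof -
  define f where "f = (\<lambda>(n, e). S e n)"
  have inner: "(\<lambda>e. norm (f (n, e))) summable_on A" if "n \<in> N" for n
    unfolding abs_summable_iff_bdd_above f_def
    using bound[OF that] by (intro bdd_aboveI2[of _ _ "b n"]) auto
  have "(\<lambda>n. infsum (\<lambda>e. norm (f (n, e))) A) summable_on N"
  proof (rule summable_on_comparison_test[OF b])
    fix n assume n: "n \<in> N"
    show "infsum (\<lambda>e. norm (f (n, e))) A \<le> b n"
      by (rule infsum_le_finite_sums[OF inner[OF n]]) (simp add: f_def bound[OF n])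
    show "0 \<le> infsum (\<lambda>e. norm (f (n, e))) A"
      by (rule infsum_nonneg) simp
  qed
  then have "(\<lambda>x. norm (f x)) summable_on (N \<times> A)"
    by (rule summable_on_SigmaI[rotated]) (use inner in \<open>auto intro: has_sum_infsum\<close>)
  then obtain T where T: "(f has_sum T) (N \<times> A)"
    using abs_summable_summable has_sum_infsum by blast
  then have T': "((\<lambda>(e, n). f (n, e)) has_sum T) (A \<times> N)"
    by (rule has_sum_swap[THEN iffD1])
  show ?thesis
  proof (rule that)
    show "(L has_sum T) N"
      by (rule has_sum_SigmaD[OF T]) (simp add: f_def L)
    show "(R has_sum T) A"
      by (rule has_sum_SigmaD[OF T']) (simp add: f_def R)
  qed
qed

text \<open>The operator sum_n |w_n><u_n|. Two families are allowed because applying Q (x) 1 to a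
  sum of |z_n><z_n| changes only the ket side.\<close>

definition outer_sum ::
    "(nat \<Rightarrow> 'b::chilbert_space) \<Rightarrow> (nat \<Rightarrow> 'a::chilbert_space) \<Rightarrow> 'a \<Rightarrow> 'b" where
  "outer_sum w u x = (\<Sum>\<^sub>\<infinity>n. (u n \<bullet>\<^sub>C x) *\<^sub>C w n)"

abbreviation square_summable :: "(nat \<Rightarrow> 'a::chilbert_space) \<Rightarrow> bool" where
  "square_summable u \<equiv> (\<lambda>n. (norm (u n))\<^sup>2) summable_on UNIV"

text \<open>Crude arithmetic-geometric bound; it supplies summable majorants for products of square
  summable families.\<close>

lemma mult_le_sum_squares: "a * b \<le> a\<^sup>2 + (b\<^sup>2::real)"
proof -
  have "0 \<le> (a - b)\<^sup>2 + a\<^sup>2 + b\<^sup>2" by simp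
  then show ?thesis by (simp add: power2_diff)
qed

lemma
  assumes "square_summable w" "square_summable u"
  shows has_sum_outer_sum: "((\<lambda>n. (u n \<bullet>\<^sub>C x) *\<^sub>C w n) has_sum outer_sum w u x) UNIV"
    and norm_outer_sum_le: "norm (outer_sum w u x)
      \<le> norm x * (\<Sum>\<^sub>\<infinity>n. ((norm (u n))\<^sup>2 + (norm (w n))\<^sup>2))"
proof -
  have b: "(\<lambda>n. (norm (u n))\<^sup>2 + (norm (w n))\<^sup>2) summable_on UNIV"
    by (intro summable_on_add assms)
  then have b': "(\<lambda>n. norm x * ((norm (u n))\<^sup>2 + (norm (w n))\<^sup>2)) summable_on UNIV"
    by (rule summable_on_cmult_right)
  have le: "norm ((u n \<bullet>\<^sub>C x) *\<^sub>C w n) \<le> norm x * ((norm (u n))\<^sup>2 + (norm (w n))\<^sup>2)" for n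
  proof -
    have "norm ((u n \<bullet>\<^sub>C x) *\<^sub>C w n) \<le> norm (u n) * norm x * norm (w n)"
      by (simp add: Cauchy_Schwarz_cinner mult_right_mono)
    also have "\<dots> = norm x * (norm (u n) * norm (w n))" by simp
    also have "\<dots> \<le> norm x * ((norm (u n))\<^sup>2 + (norm (w n))\<^sup>2)"
      by (intro mult_left_mono mult_le_sum_squares) simp
    finally show ?thesis .
  qed
  have s: "(\<lambda>n. norm ((u n \<bullet>\<^sub>C x) *\<^sub>C w n)) summable_on UNIV"
    by (rule summable_on_comparison_test[OF b' le]) simp
  show "((\<lambda>n. (u n \<bullet>\<^sub>C x) *\<^sub>C w n) has_sum outer_sum w u x) UNIV"
    unfolding outer_sum_def by (rule has_sum_infsum[OF abs_summable_summable[OF s]])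
  have "norm (outer_sum w u x) \<le> (\<Sum>\<^sub>\<infinity>n. norm ((u n \<bullet>\<^sub>C x) *\<^sub>C w n))"
    unfolding outer_sum_def by (rule norm_infsum_bound[OF s])
  also have "\<dots> \<le> (\<Sum>\<^sub>\<infinity>n. norm x * ((norm (u n))\<^sup>2 + (norm (w n))\<^sup>2))"
    by (rule infsum_mono[OF s b' le])
  also have "\<dots> = norm x * (\<Sum>\<^sub>\<infinity>n. ((norm (u n))\<^sup>2 + (norm (w n))\<^sup>2))"
    by (rule infsum_cmult_right[OF b])
  finally show "norm (outer_sum w u x) \<le> \<dots>" .
qed

lemma outer_sum_eqI:
  "((\<lambda>n. (u n \<bullet>\<^sub>C x) *\<^sub>C w n) has_sum y) UNIV \<Longrightarrow> outer_sum w u x = y"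
  unfolding outer_sum_def by (rule infsumI)

lemma bounded_clinear_outer_sum:
  assumes "square_summable w" "square_summable u"
  shows "bounded_clinear (outer_sum w u)"
proof (rule bounded_clinearI)
  note * = has_sum_outer_sum[OF assms]
  fix x y
  show "outer_sum w u (x + y) = outer_sum w u x + outer_sum w u y"
    using has_sum_add[OF *[of x] *[of y]]
    by (intro outer_sum_eqI) (simp add: cinner_simps scaleC_add_left)
  fix c
  show "outer_sum w u (c *\<^sub>C x) = c *\<^sub>C outer_sum w u x"
    using has_sum_bounded_linear[OF bounded_linear_scaleC_right *[of x], of c]
    by (intro outer_sum_eqI) (simp add: o_def cinner_simps scaleC_scaleC)
qed (rule norm_outer_sum_le[OF assms])

section \<open>Decomposition of positive operators\<close>

text \<open>A y / sqrt <y, A y>. If the pivot <y, A y> is 0, then \<open>inverse 0 = 0\<close>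
  yields the zero vector and the elimination step changes nothing.\<close>

definition schur_vec :: "('a::chilbert_space \<Rightarrow> 'a) \<Rightarrow> 'a \<Rightarrow> 'a" where
  "schur_vec A y = complex_of_real (inverse (sqrt (Re (y \<bullet>\<^sub>C A y)))) *\<^sub>C A y"

text \<open>The Schur complement A - |A y><A y| / <y, A y>, one step of Cholesky
  elimination.\<close>

definition schur_step :: "('a::chilbert_space \<Rightarrow> 'a) \<Rightarrow> 'a \<Rightarrow> 'a \<Rightarrow> 'a" where
  "schur_step A y x = A x - (schur_vec A y \<bullet>\<^sub>C x) *\<^sub>C schur_vec A y"

lemma cinner_rank_one: "x \<bullet>\<^sub>C ((v \<bullet>\<^sub>C x) *\<^sub>C v) = complex_of_real ((cmod (v \<bullet>\<^sub>C x))\<^sup>2)"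
  by (simp add: cinner_scaleC_right cinner_mult_commute)

lemma bounded_clinear_rank_one: "bounded_clinear (\<lambda>x::'a::chilbert_space. (v \<bullet>\<^sub>C x) *\<^sub>C (w::'b::chilbert_space))"
proof (rule bounded_clinearI)
  show "norm ((v \<bullet>\<^sub>C x) *\<^sub>C w) \<le> norm x * (norm v * norm w)" for x
    using mult_right_mono[OF Cauchy_Schwarz_cinner[of v x], of "norm w"] by (simp add: mult_ac)
qed (simp_all add: cinner_simps scaleC_add_left scaleC_scaleC)

text \<open>Positivity of the Schur complement is the inequality |<A y, x>|^2 / <y, A y> <= <x, A
  x>, that is, Cauchy-Schwarz for A.\<close>

lemma positive_op_schur_step:
  assumes "positive_op A"
  shows "positive_op (schur_step A y)"
  unfolding positive_op_def
proof (intro conjI allI)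
  have "schur_step A y = (\<lambda>x. A x - (schur_vec A y \<bullet>\<^sub>C x) *\<^sub>C schur_vec A y)"
    by (auto simp: schur_step_def)
  then show "bounded_clinear (schur_step A y)"
    using bounded_clinear_diff[OF positive_opD(1)[OF assms] bounded_clinear_rank_one] by metis
  fix x
  define b where "b = Re (y \<bullet>\<^sub>C A y)"
  have b: "b \<ge> 0" unfolding b_def by (rule positive_opD[OF assms])
  have "(cmod (schur_vec A y \<bullet>\<^sub>C x))\<^sup>2 = inverse b * (cmod (A y \<bullet>\<^sub>C x))\<^sup>2"
    using b unfolding schur_vec_def b_def[symmetric]
    by (simp add: cinner_scaleC_left norm_mult power_mult_distrib norm_inverse power_inverse)
  also have "\<dots> \<le> inverse b * (Re (y \<bullet>\<^sub>C A y) * Re (x \<bullet>\<^sub>C A x))"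
    using b positive_op_Cauchy_Schwarz[OF assms, of x y]
    by (intro mult_left_mono) (simp_all add: cmod_cinner_commute[of "A y" x])
  also have "\<dots> \<le> Re (x \<bullet>\<^sub>C A x)"
    using positive_opD(3)[OF assms, of x] by (cases "b = 0") (auto simp flip: b_def mult.assoc)
  finally show "x \<bullet>\<^sub>C schur_step A y x \<in> \<real>\<^sub>\<ge>\<^sub>0"
    using positive_opD(2)[OF assms, of x]
    by (simp add: schur_step_def cinner_diff_right cinner_rank_one complex_nonneg_Reals_iff
        del: of_real_power)
qed

text \<open>The coefficient <A y, y> / <y, A y> is 1, so A y cancels; for a zero pivot A y is
  already 0.\<close>

lemma schur_step_self:
  assumes "positive_op A"
  shows "schur_step A y y = 0"
proof (cases "Re (y \<bullet>\<^sub>C A y) = 0")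
  case True
  then have "y \<bullet>\<^sub>C A y = 0" using positive_opD(2)[OF assms] by (simp add: complex_eq_iff)
  then have "A y = 0" by (rule positive_op_zero[OF assms])
  then show ?thesis by (simp add: schur_step_def schur_vec_def)
next
  case False
  define b where "b = Re (y \<bullet>\<^sub>C A y)"
  have b: "b > 0" using False positive_opD(3)[OF assms, of y] unfolding b_def by simp
  have "A y \<bullet>\<^sub>C y = complex_of_real b"
    using positive_opD(2)[OF assms, of y]
    by (simp add: b_def complex_eq_iff flip: positive_op_selfadjoint[OF assms])
  then have "(schur_vec A y \<bullet>\<^sub>C y) *\<^sub>C schur_vec A y
      = complex_of_real (inverse (sqrt b) * b * inverse (sqrt b)) *\<^sub>C A y"
    unfolding schur_vec_def b_def[symmetric] by (simp add: cinner_simps scaleC_scaleC)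
  also have "inverse (sqrt b) * b * inverse (sqrt b) = 1"
    using b by (simp add: field_simps)
  finally show ?thesis by (simp add: schur_step_def scaleC_one)
qed

text \<open>If A x = 0 then <A y, x> = <y, A x> = 0. Hence eliminated vectors are not disturbed by
  later steps.\<close>

lemma schur_step_kernel:
  assumes "positive_op A" "A x = 0"
  shows "schur_step A y x = 0"
  using assms(2)
  by (simp add: schur_step_def schur_vec_def cinner_simps flip: positive_op_selfadjoint[OF assms(1)])

primrec schur :: "('a::chilbert_space \<Rightarrow> 'a) \<Rightarrow> (nat \<Rightarrow> 'a) \<Rightarrow> nat \<Rightarrow> 'a \<Rightarrow> 'a" where
  "schur A e 0 = A"
| "schur A e (Suc n) = schur_step (schur A e n) (e n)"

lemma positive_op_schur: "positive_op A \<Longrightarrow> positive_op (schur A e n)"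
  by (induction n) (auto intro: positive_op_schur_step)

lemma schur_kernel_mono:
  assumes "positive_op A" "schur A e m x = 0" "m \<le> n"
  shows "schur A e n x = 0"
  using assms(3)
  by (induction n rule: dec_induct)
    (simp_all add: assms(2) schur_step_kernel[OF positive_op_schur[OF assms(1)]])

lemma schur_eq_diff_sum:
  "schur A e n x = A x -
    (\<Sum>k<n. (schur_vec (schur A e k) (e k) \<bullet>\<^sub>C x) *\<^sub>C schur_vec (schur A e k) (e k))"
  by (induction n) (auto simp: schur_step_def)

lemma schur_form_le: "Re (x \<bullet>\<^sub>C schur A e n x) \<le> Re (x \<bullet>\<^sub>C A x)"
  by (auto simp: schur_eq_diff_sum cinner_diff_right cinner_sum_right cinner_rank_one
      intro!: sum_nonneg)

text \<open>The bound is uniform in n, so strong convergence can pass from a dense set to the whole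
  space. Only the forms decrease; Cauchy-Schwarz for the n-th complement, tested with its own value
  at x, converts this into a norm bound.\<close>

lemma norm_schur_le:
  assumes "positive_op A" and K: "\<And>x. norm (A x) \<le> norm x * K" "K \<ge> 0"
  shows "norm (schur A e n x) \<le> K * norm x"
proof -
  have form: "Re (x \<bullet>\<^sub>C schur A e n x) \<le> K * (norm x)\<^sup>2" for x
  proof -
    have "Re (x \<bullet>\<^sub>C schur A e n x) \<le> cmod (x \<bullet>\<^sub>C A x)"
      using schur_form_le complex_Re_le_cmod order_trans by blast
    also have "\<dots> \<le> norm x * norm (A x)" by (rule Cauchy_Schwarz_cinner)
    also have "\<dots> \<le> norm x * (norm x * K)" by (intro mult_left_mono K) simp
    finally show ?thesis by (simp add: power2_eq_square mult_ac)
  qed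
  define y where "y = schur A e n x"
  note pos = positive_op_schur[OF assms(1), of e n]
  have "((norm y)\<^sup>2)\<^sup>2 = (cmod (y \<bullet>\<^sub>C schur A e n x))\<^sup>2"
    unfolding y_def[symmetric] by (simp add: cinner_self norm_power)
  also have "\<dots> \<le> Re (x \<bullet>\<^sub>C schur A e n x) * Re (y \<bullet>\<^sub>C schur A e n y)"
    by (rule positive_op_Cauchy_Schwarz[OF pos])
  also have "\<dots> \<le> (K * (norm x)\<^sup>2) * (K * (norm y)\<^sup>2)"
    using K(2) by (intro mult_mono form positive_opD[OF pos]) auto
  also have "\<dots> = (K * norm x * norm y)\<^sup>2" by (simp add: power2_eq_square mult_ac)
  finally have "norm y * norm y \<le> (K * norm x) * norm y"
    using K(2) by (auto simp: power2_eq_square[of "norm y"] dest!: power2_le_imp_le)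
  then have "norm y \<le> K * norm x"
    using K(2) by (cases "norm y = 0") (auto simp: mult_le_cancel_right)
  then show ?thesis unfolding y_def .
qed

text \<open>Only countably many vectors of an orthonormal basis have a nonzero diagonal entry. Eliminating
  them one by one through Schur complements, as in the Cholesky decomposition, writes the operator
  as a sum of positive rank one operators.\<close>

lemma positive_op_decomposition:
  fixes A :: "'a::chilbert_space \<Rightarrow> 'a"
  assumes A: "positive_op A" and E: "is_onb E"
    and tr: "((\<lambda>e. e \<bullet>\<^sub>C A e) has_sum c) E"
  obtains v where "((\<lambda>n. (norm (v n))\<^sup>2) has_sum Re c) UNIV" "A = outer_sum v v"
proof -
  obtain K where K: "\<And>x. norm (A x) \<le> norm x * K" "K \<ge> 0"
    using bounded_linear.nonneg_bounded[OF bounded_clinearD(1)[OF positive_opD(1)[OF A]]] by metis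
  define D where "D = {e \<in> E. Re (e \<bullet>\<^sub>C A e) \<noteq> 0}"
  have trRe: "((\<lambda>e. Re (e \<bullet>\<^sub>C A e)) has_sum Re c) E" by (rule has_sum_Re[OF tr])
  have "countable D"
    unfolding D_def
    by (rule summable_countable_real) (use trRe in \<open>auto simp: summable_on_def\<close>)
  \<comment> \<open>Adding 0 keeps the enumerated set nonempty. Pivoting at 0, or again at a vector
    already eliminated, subtracts nothing.\<close>
  define e where "e = from_nat_into (insert 0 D)"
  have surj: "\<exists>n. e n = x" if "x \<in> D" for x
    using that \<open>countable D\<close> unfolding e_def
    by (metis countable_insert from_nat_into_to_nat_on insertCI)
  define v where "v n = schur_vec (schur A e n) (e n)" for n
  define S where "S n = schur A e n" for n
  note S_pos = positive_op_schur[OF A, of e, folded S_def]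
  note S_lin = bounded_clinearD[OF positive_opD(1)[OF S_pos]]
  have S_le: "norm (S n x) \<le> K * norm x" for n x
    unfolding S_def by (rule norm_schur_le[OF A K])
  have S_eq: "S n x = A x - (\<Sum>k<n. (v k \<bullet>\<^sub>C x) *\<^sub>C v k)" for n x
    unfolding S_def v_def by (rule schur_eq_diff_sum)
  have base: "(\<lambda>n. S n x) \<longlonglongrightarrow> 0" if "x \<in> E" for x
  proof -
    \<comment> \<open>On basis vectors the complement vanishes after finitely many steps: either x
      is a pivot, or its diagonal entry is 0 and A x = 0 from the start.\<close>
    have "\<exists>m. S m x = 0"
    proof (cases "x \<in> D")
      case True
      then obtain m where "e m = x" using surj by blast
      then have "S (Suc m) x = 0"
        unfolding S_def using schur_step_self positive_op_schur[OF A] by auto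
      then show ?thesis by blast
    next
      case False
      then have "x \<bullet>\<^sub>C A x = 0"
        using that positive_opD(2)[OF A] unfolding D_def by (simp add: complex_eq_iff)
      then have "S 0 x = 0" unfolding S_def by (simp add: positive_op_zero[OF A])
      then show ?thesis by blast
    qed
    then obtain m where "S m x = 0" by blast
    then have "\<forall>\<^sub>F n in sequentially. S n x = 0"
      unfolding S_def eventually_sequentially using schur_kernel_mono[OF A] by blast
    then show ?thesis by (rule tendsto_eventually)
  qed
  have span: "(\<lambda>n. S n x) \<longlonglongrightarrow> 0" if "x \<in> complex_vector.span E" for x
    using that
  proof (induction rule: complex_vector.span_induct_alt)
    case base
    show ?case by (simp add: S_lin)
  next
    case (step c x y)
    have "(\<lambda>n. c *\<^sub>C S n x + S n y) \<longlonglongrightarrow> c *\<^sub>C 0 + 0"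
      by (intro tendsto_add bounded_linear.tendsto[OF bounded_linear_scaleC_right] base step)
    then show ?case by (simp add: S_lin)
  qed
  have lim: "(\<lambda>n. S n x) \<longlonglongrightarrow> 0" for x
  proof (rule tendstoI)
    fix \<epsilon> :: real assume \<epsilon>: "\<epsilon> > 0"
    have "x \<in> closure (complex_vector.span E)" using is_onbD(4)[OF E] by simp
    \<comment> \<open>K + 1 instead of K avoids division by zero when A = 0.\<close>
    then obtain s where s: "s \<in> complex_vector.span E" "dist s x < \<epsilon> / (2 * (K + 1))"
      using \<epsilon> K(2) unfolding closure_approachable by (metis add_nonneg_pos divide_pos_pos
          mult_pos_pos zero_less_numeral zero_less_one)
    have "\<forall>\<^sub>F n in sequentially. norm (S n s) < \<epsilon> / 2"
      using tendstoD[OF span[OF s(1)], of "\<epsilon> / 2"] \<epsilon> by simp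
    then show "\<forall>\<^sub>F n in sequentially. dist (S n x) 0 < \<epsilon>"
    proof (rule eventually_mono)
      fix n assume n: "norm (S n s) < \<epsilon> / 2"
      have "norm (S n x) \<le> norm (S n s) + norm (S n (x - s))"
        using norm_triangle_ineq[of "S n s" "S n (x - s)"] by (simp add: S_lin)
      also have "norm (S n (x - s)) \<le> (K + 1) * norm (x - s)"
        using S_le[of n "x - s"] norm_ge_zero[of "x - s"] unfolding distrib_right by linarith
      also have "(K + 1) * norm (x - s) \<le> \<epsilon> / 2"
        using s(2) K(2) by (simp add: dist_norm norm_minus_commute field_simps)
      finally show "dist (S n x) 0 < \<epsilon>" using n by simp
    qed
  qed
  have sums: "(\<lambda>k. (v k \<bullet>\<^sub>C x) *\<^sub>C v k) sums A x" for x
  proof -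
    have "(\<lambda>n. A x - S n x) \<longlonglongrightarrow> A x - 0" by (intro tendsto_intros lim)
    then show ?thesis unfolding sums_def by (simp add: S_eq)
  qed
  \<comment> \<open>Nonnegative terms upgrade the ordered series to an unconditional sum.\<close>
  have form: "((\<lambda>n. (cmod (v n \<bullet>\<^sub>C x))\<^sup>2) has_sum Re (x \<bullet>\<^sub>C A x)) UNIV" for x
  proof (rule sums_nonneg_imp_has_sum)
    have "(\<lambda>n. Re (x \<bullet>\<^sub>C ((v n \<bullet>\<^sub>C x) *\<^sub>C v n))) sums Re (x \<bullet>\<^sub>C A x)"
      by (intro sums_Re bounded_linear.sums[OF bounded_linear_cinner_right] sums)
    then show "(\<lambda>n. (cmod (v n \<bullet>\<^sub>C x))\<^sup>2) sums Re (x \<bullet>\<^sub>C A x)"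
      unfolding cinner_rank_one by simp
  qed simp
  \<comment> \<open>Double sum of |<v_n, e>|^2: over n it gives the diagonal entry <e, A e>, over e
    it gives |v_n|^2. The diagonal entries serve as the majorant.\<close>
  have norms: "((\<lambda>n. (norm (v n))\<^sup>2) has_sum Re c) UNIV"
  proof (rule has_sum_iterated_swap[of E UNIV "\<lambda>n e. (cmod (v n \<bullet>\<^sub>C e))\<^sup>2" "\<lambda>e. Re (e \<bullet>\<^sub>C A e)"
        "\<lambda>e. Re (e \<bullet>\<^sub>C A e)" "\<lambda>n. (norm (v n))\<^sup>2"])
    fix T assume "((\<lambda>e. Re (e \<bullet>\<^sub>C A e)) has_sum T) E" "((\<lambda>n. (norm (v n))\<^sup>2) has_sum T) UNIV"
    then show ?thesis using trRe has_sum_unique by blast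
  next
    show "(\<lambda>e. Re (e \<bullet>\<^sub>C A e)) summable_on E" using trRe unfolding summable_on_def by blast
    show "((\<lambda>e. (cmod (v n \<bullet>\<^sub>C e))\<^sup>2) has_sum (norm (v n))\<^sup>2) E" for n
      by (rule parseval_norm[OF E])
    show "(\<Sum>n\<in>F. norm ((cmod (v n \<bullet>\<^sub>C x))\<^sup>2)) \<le> Re (x \<bullet>\<^sub>C A x)" if "finite F" for F x
      using finite_sum_le_has_sum[OF form that] by simp
  qed (rule form)
  have sq: "square_summable v" using norms unfolding summable_on_def by blast
  have "A x = outer_sum v v x" for x
    using has_sum_imp_sums[OF has_sum_outer_sum[OF sq sq]] sums sums_unique2 by blast
  then show ?thesis using that norms by blast
qed

section \<open>Tensor products\<close>

lemma hilbert_tensorD: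
  assumes "hilbert_tensor tensor"
  shows "tensor (a + a') b = tensor a b + tensor a' b"
    "tensor a (b + b') = tensor a b + tensor a b'"
    "tensor (c *\<^sub>C a) b = c *\<^sub>C tensor a b"
    "tensor a (c *\<^sub>C b) = c *\<^sub>C tensor a b"
    "tensor a b \<bullet>\<^sub>C tensor a' b' = (a \<bullet>\<^sub>C a') * (b \<bullet>\<^sub>C b')"
    "closure (complex_vector.span {tensor a b |a b. True}) = UNIV"
  using assms unfolding hilbert_tensor_def by blast+

lemma norm_tensor:
  assumes "hilbert_tensor tensor"
  shows "norm (tensor a b) = norm a * norm b"
proof -
  have "complex_of_real ((norm (tensor a b))\<^sup>2) = complex_of_real ((norm a * norm b)\<^sup>2)"
    unfolding cinner_self[symmetric] hilbert_tensorD(5)[OF assms]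
    by (simp add: cinner_self power_mult_distrib)
  then have "(norm (tensor a b))\<^sup>2 = (norm a * norm b)\<^sup>2"
    using of_real_eq_iff by blast
  then show ?thesis by (simp add: power2_eq_iff_nonneg)
qed

lemma bounded_clinear_tensor:
  assumes "hilbert_tensor tensor"
  shows "bounded_clinear (tensor a)" "bounded_clinear (\<lambda>a. tensor a b)"
  by (rule bounded_clinearI[where K = "norm a"] bounded_clinearI[where K = "norm b"];
      simp add: hilbert_tensorD(1-4)[OF assms] norm_tensor[OF assms])+

lemma bounded_clinear_eq_on_tensors:
  assumes "hilbert_tensor tensor" "bounded_clinear C" "bounded_clinear D"
    and "\<And>a b. C (tensor a b) = D (tensor a b)"
  shows "C = D"
proof
  fix x
  have "x \<in> closure (complex_vector.span {tensor a b |a b. True})"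
    using hilbert_tensorD(6)[OF assms(1)] by simp
  then show "C x = D x"
  proof (induction rule: closure_span_induct)
    case closed
    show ?case
      by (intro closed_Collect_eq linear_continuous_on bounded_clinearD(1) assms)
  qed (auto simp: assms(4) bounded_clinearD[OF assms(2)] bounded_clinearD[OF assms(3)])
qed

text \<open>Density of the elementary tensors gives uniqueness. Existence comes from an explicit C
  at each use: a projection, its complement, or a sum of rank one operators.\<close>

lemma op_tensor_eqI:
  assumes "hilbert_tensor tensor" "bounded_clinear C"
    and "\<And>a b. C (tensor a b) = tensor (A a) (B b)"
  shows "op_tensor tensor A B = C"
  unfolding op_tensor_def
proof (rule the_equality)
  fix C' assume "bounded_clinear C' \<and> (\<forall>a b. C' (tensor a b) = tensor (A a) (B b))"
  then show "C' = C"
    using assms by (intro bounded_clinear_eq_on_tensors[OF assms(1)]) auto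
qed (use assms in blast)

text \<open>The projection onto the closed span of S. Its criterion for P x = y tests orthogonality
  against the generators only, so P can be evaluated on elementary tensors.\<close>

lemma projection_operator:
  obtains P where "bounded_clinear P"
    and "\<And>x y. y \<in> closure (complex_vector.span S) \<Longrightarrow>
      (\<And>z. z \<in> S \<Longrightarrow> z \<bullet>\<^sub>C (x - y) = 0) \<Longrightarrow> P x = y"
    and "\<And>x y. x \<bullet>\<^sub>C P y = P x \<bullet>\<^sub>C y"
    and "\<And>x. P (P x) = (P x :: 'a::chilbert_space)"
proof -
  define C where "C = closure (complex_vector.span S)"
  have "\<forall>x. \<exists>y. y \<in> C \<and> (\<forall>z\<in>C. z \<bullet>\<^sub>C (x - y) = 0)"
    unfolding C_def using projection_exists by meson
  then obtain P where PC: "\<And>x. P x \<in> C" and P: "\<And>x z. z \<in> C \<Longrightarrow> z \<bullet>\<^sub>C (x - P x) = 0"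
    by metis
  have add: "a + b \<in> C" if "a \<in> C" "b \<in> C" for a b
    using that unfolding C_def by (rule closed_subspace_closure_span)
  have scale: "c *\<^sub>C a \<in> C" if "a \<in> C" for a c
    using that unfolding C_def by (rule closed_subspace_closure_span)
  have uniq: "P x = y" if y: "y \<in> C" "\<And>z. z \<in> C \<Longrightarrow> z \<bullet>\<^sub>C (x - y) = 0" for x y
  proof -
    define d where "d = y - P x"
    have "d = y + (-1) *\<^sub>C P x"
      unfolding d_def by (simp add: scaleC_minus_left scaleC_one)
    then have "d \<in> C" using add scale y(1) PC by metis
    \<comment> \<open>The two residuals are orthogonal to C and differ by d, which lies in
      C.\<close>
    then have "d \<bullet>\<^sub>C ((x - P x) - (x - y)) = 0"
      unfolding cinner_diff_right[of d "x - P x"] using P y(2) by simp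
    then have "d \<bullet>\<^sub>C d = 0" unfolding d_def by simp
    then show ?thesis unfolding d_def by simp
  qed
  have left: "(x - P x) \<bullet>\<^sub>C z = 0" if "z \<in> C" for x z
    using P[OF that] by (metis cinner_commute complex_cnj_zero)
  have "bounded_clinear P"
  proof (rule bounded_clinearI)
    fix x y
    have "x + y - (P x + P y) = (x - P x) + (y - P y)" by simp
    then show "P (x + y) = P x + P y"
      by (intro uniq add PC) (simp only: cinner_add_right P add_0)
  next
    fix c x
    show "P (c *\<^sub>C x) = c *\<^sub>C P x"
      by (intro uniq scale PC) (simp only: cinner_scaleC_right P mult_zero_right flip: scaleC_diff_right)
  next
    fix x
    have "(norm (P x + (x - P x)))\<^sup>2 = (norm (P x))\<^sup>2 + (norm (x - P x))\<^sup>2"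
      unfolding norm_add_square using P[OF PC] by simp
    then have "(norm (P x))\<^sup>2 \<le> (norm x)\<^sup>2" by simp
    then show "norm (P x) \<le> norm x * 1" using power2_le_imp_le by fastforce
  qed
  moreover have "P x = y" if "y \<in> closure (complex_vector.span S)"
    and *: "\<And>z. z \<in> S \<Longrightarrow> z \<bullet>\<^sub>C (x - y) = 0" for x y
    using that(1) orthogonal_closure_span[where S = S and z = "x - y", OF _ *]
    unfolding C_def[symmetric] by (intro uniq) blast+
  moreover have "x \<bullet>\<^sub>C P y = P x \<bullet>\<^sub>C y" for x y
    using P[OF PC[of x], of y] left[OF PC[of y], of x] by (simp add: cinner_simps)
  moreover have "P (P x) = P x" for x
    by (intro uniq PC) simp
  ultimately show ?thesis by (rule that)
qed

lemma orthogonal_projectionD: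
  assumes "orthogonal_projection Q"
  shows "x \<bullet>\<^sub>C Q y = Q x \<bullet>\<^sub>C y" "Q (Q x) = Q x"
  using assms cinner_cadjoint_left[of Q x y] unfolding orthogonal_projection_def
  by (auto simp: o_def fun_eq_iff)

text \<open>The operator \<open>Q \<otimes> 1\<close> is the projection onto the closed span of the vectors \<open>Q a \<otimes> b\<close>.\<close>

lemma op_tensor_projection:
  assumes H: "hilbert_tensor tensor" and Q: "orthogonal_projection Q"
  defines "Q' \<equiv> op_tensor tensor Q id"
  shows "bounded_clinear Q'" "Q' (tensor a b) = tensor (Q a) b" "x \<bullet>\<^sub>C Q' y = Q' x \<bullet>\<^sub>C y"
    "Q' (Q' x) = Q' x" "op_tensor tensor (\<lambda>x. x - Q x) id = (\<lambda>x. x - Q' x)"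
proof -
  note T = hilbert_tensorD(1-5)[OF H]
  define S where "S = {tensor (Q a) b |a b. True}"
  obtain P where P: "bounded_clinear P"
    "\<And>x y. y \<in> closure (complex_vector.span S) \<Longrightarrow> (\<And>z. z \<in> S \<Longrightarrow> z \<bullet>\<^sub>C (x - y) = 0) \<Longrightarrow> P x = y"
    "\<And>x y. x \<bullet>\<^sub>C P y = P x \<bullet>\<^sub>C y" "\<And>x. P (P x) = P x"
    using projection_operator[of S] by metis
  have Pt: "P (tensor a b) = tensor (Q a) b" for a b
  proof (rule P(2))
    have "tensor (Q a) b \<in> S" unfolding S_def by blast
    then show "tensor (Q a) b \<in> closure (complex_vector.span S)"
      using closure_subset complex_vector.span_base by blast
    fix z assume "z \<in> S"
    then obtain a' b' where z: "z = tensor (Q a') b'" unfolding S_def by blast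
    have "Q a' \<bullet>\<^sub>C Q a = Q a' \<bullet>\<^sub>C a" by (simp add: orthogonal_projectionD[OF Q])
    then show "z \<bullet>\<^sub>C (tensor a b - tensor (Q a) b) = 0"
      unfolding z cinner_diff_right T(5) by simp
  qed
  have Q': "Q' = P"
    unfolding Q'_def by (rule op_tensor_eqI[OF H P(1)]) (simp add: Pt)
  show "bounded_clinear Q'" "Q' (tensor a b) = tensor (Q a) b" "x \<bullet>\<^sub>C Q' y = Q' x \<bullet>\<^sub>C y"
    "Q' (Q' x) = Q' x"
    unfolding Q' by (fact P Pt)+
  show "op_tensor tensor (\<lambda>x. x - Q x) id = (\<lambda>x. x - Q' x)"
  proof (rule op_tensor_eqI[OF H])
    show "bounded_clinear (\<lambda>x. x - Q' x)"
      using bounded_clinear_diff[OF bounded_clinear_id P(1)] by (simp add: Q')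
    show "tensor a b - Q' (tensor a b) = tensor (a - Q a) (id b)" for a b
      using bounded_clinearD(4)[OF bounded_clinear_tensor(2)[OF H]] by (simp add: Q' Pt)
  qed
qed

section \<open>Traces of sums of rank one operators\<close>

lemma cadjoint_ketbra: "cadjoint (ketbra \<psi> \<phi>) = ketbra \<phi> \<psi>"
proof (rule cadjoint_eqI)
  fix x y
  show "ketbra \<phi> \<psi> x \<bullet>\<^sub>C y = x \<bullet>\<^sub>C ketbra \<psi> \<phi> y"
    using cinner_commute[of x \<psi>] by (simp add: ketbra_def cinner_simps)
qed

lemma positive_op_ketbra: "positive_op (ketbra \<psi> \<psi>)"
  unfolding positive_op_def
proof (intro conjI allI)
  show "bounded_clinear (ketbra \<psi> \<psi>)"
    unfolding ketbra_def by (rule bounded_clinear_rank_one)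
  show "x \<bullet>\<^sub>C ketbra \<psi> \<psi> x \<in> \<real>\<^sub>\<ge>\<^sub>0" for x
    unfolding ketbra_def cinner_rank_one by (simp add: complex_nonneg_Reals_iff)
qed

text \<open>Uniqueness needed to evaluate \<open>abs_op\<close>. Since |P x|^2 = <x, P (P x)>, the
  root P vanishes on the complement of psi, so it is determined by P psi.\<close>

lemma positive_sqrt_ketbra_unique:
  assumes P: "positive_op P" and sq: "P \<circ> P = ketbra \<psi> \<psi> \<circ> ketbra \<psi> \<psi>"
  shows "P = ketbra \<psi> \<psi>"
proof -
  note lin = bounded_clinearD[OF positive_opD(1)[OF P]]
  note sa = positive_op_selfadjoint[OF P]
  define p where "p = complex_of_real ((norm \<psi>)\<^sup>2)"
  have pp: "\<psi> \<bullet>\<^sub>C \<psi> = p" unfolding p_def by (rule cinner_self)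
  have PP: "P (P x) = ((\<psi> \<bullet>\<^sub>C x) * p) *\<^sub>C \<psi>" for x
    using fun_cong[OF sq, of x] by (simp add: ketbra_def cinner_simps pp scaleC_scaleC mult.commute)
  have perp: "P x = 0" if "\<psi> \<bullet>\<^sub>C x = 0" for x
  proof -
    have "P x \<bullet>\<^sub>C P x = x \<bullet>\<^sub>C P (P x)" by (simp add: sa)
    then show ?thesis using that by (simp add: PP)
  qed
  show ?thesis
  proof (cases "\<psi> = 0")
    case True
    then show ?thesis using perp by (auto simp: ketbra_def)
  next
    case False
    then have p0: "p \<noteq> 0" unfolding p_def by simp
    have dec: "P x = ((\<psi> \<bullet>\<^sub>C x) / p) *\<^sub>C P \<psi>" for x
    proof -
      have "P (x - ((\<psi> \<bullet>\<^sub>C x) / p) *\<^sub>C \<psi>) = 0"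
        by (rule perp) (use p0 pp in \<open>simp add: cinner_simps\<close>)
      then show ?thesis by (simp add: lin)
    qed
    define q where "q = \<psi> \<bullet>\<^sub>C P \<psi>"
    have q: "Im q = 0" "Re q \<ge> 0" unfolding q_def using positive_opD[OF P] by auto
    have "P (P \<psi>) = (q / p) *\<^sub>C P \<psi>" by (subst dec) (simp add: q_def)
    then have "\<psi> \<bullet>\<^sub>C ((q / p) *\<^sub>C P \<psi>) = \<psi> \<bullet>\<^sub>C ((p * p) *\<^sub>C \<psi>)" by (simp add: PP pp)
    \<comment> \<open>q^2 = p^4 leaves a sign open; positivity of P selects q = p^2.\<close>
    then have "q * q = (p * p) * (p * p)"
      using p0 by (simp add: cinner_simps pp flip: q_def) (simp add: field_simps)
    then have "complex_of_real ((Re q)\<^sup>2) = complex_of_real (((norm \<psi>)\<^sup>2 * (norm \<psi>)\<^sup>2)\<^sup>2)"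
      using q(1) unfolding p_def by (simp add: complex_eq_iff power2_eq_square)
    then have "(Re q)\<^sup>2 = ((norm \<psi>)\<^sup>2 * (norm \<psi>)\<^sup>2)\<^sup>2" using of_real_eq_iff by blast
    then have "Re q = (norm \<psi>)\<^sup>2 * (norm \<psi>)\<^sup>2"
      using q(2) by (rule power2_eq_imp_eq) simp
    then have q_eq: "q = p * p" using q(1) unfolding p_def by (simp add: complex_eq_iff)
    define d where "d = P \<psi> - p *\<^sub>C \<psi>"
    \<comment> \<open>With q = p^2 the expansion of |P psi - p psi|^2 is p^3 - p q - p q + p^3 =
      0.\<close>
    have "d \<bullet>\<^sub>C d = P \<psi> \<bullet>\<^sub>C P \<psi> - p * (P \<psi> \<bullet>\<^sub>C \<psi>) - cnj p * q + cnj p * p * p"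
      unfolding d_def by (simp add: cinner_simps pp q_def algebra_simps)
    also have "P \<psi> \<bullet>\<^sub>C P \<psi> = p * p * p"
      using sa[of \<psi> "P \<psi>"] by (simp add: PP cinner_simps pp)
    also have "P \<psi> \<bullet>\<^sub>C \<psi> = q" using sa[of \<psi> \<psi>] by (simp add: q_def)
    also have "cnj p = p" unfolding p_def by simp
    finally have "d \<bullet>\<^sub>C d = 0" unfolding q_eq by simp
    then have "P \<psi> = p *\<^sub>C \<psi>" unfolding d_def by simp
    then show ?thesis
      using p0 by (intro ext, subst dec) (simp add: ketbra_def scaleC_scaleC)
  qed
qed

text \<open>The defining equations of T and M are assumed on trace class operators, so this gives
  access to them. The diagonal sum is Parseval for psi.\<close>

lemma trace_class_ketbra: "trace_class (ketbra \<psi> \<psi>)"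
proof -
  have "abs_op (ketbra \<psi> \<psi>) = ketbra \<psi> \<psi>"
    unfolding abs_op_def cadjoint_ketbra
    by (rule the_equality) (auto simp: positive_op_ketbra positive_sqrt_ketbra_unique)
  moreover have "(\<lambda>e. e \<bullet>\<^sub>C ketbra \<psi> \<psi> e) summable_on some_onb"
    using parseval[OF is_onb_some_onb, of \<psi> \<psi>] unfolding summable_on_def
    by (auto simp: ketbra_def cinner_scaleC_right)
  ultimately show ?thesis
    unfolding trace_class_def using positive_opD(1)[OF positive_op_ketbra] by simp
qed

lemma square_summable_bounded:
  assumes "bounded_linear A" "square_summable u"
  shows "square_summable (\<lambda>n. A (u n))"
proof -
  obtain K where K: "\<And>x. norm (A x) \<le> norm x * K"
    using bounded_linear.bounded[OF assms(1)] by metis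
  have "(\<lambda>n. K\<^sup>2 * (norm (u n))\<^sup>2) summable_on UNIV"
    by (rule summable_on_cmult_right[OF assms(2)])
  moreover have "(norm (A (u n)))\<^sup>2 \<le> K\<^sup>2 * (norm (u n))\<^sup>2" for n
    using power_mono[OF K[of "u n"], of 2] by (simp add: power_mult_distrib mult.commute)
  ultimately show ?thesis by (rule summable_on_comparison_test) simp
qed

lemma bounded_clinear_apply_outer_sum:
  assumes "bounded_clinear A" "square_summable w" "square_summable u"
  shows "A (outer_sum w u x) = outer_sum (\<lambda>n. A (w n)) u x"
  using has_sum_bounded_linear[OF bounded_clinearD(1)[OF assms(1)] has_sum_outer_sum[OF assms(2,3)]]
  by (intro outer_sum_eqI[symmetric]) (simp add: o_def bounded_clinearD[OF assms(1)])

text \<open>Both sides agree on a (x) b because <v_n (x) psi, a (x) b> factorizes.\<close>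

lemma op_tensor_ketbra:
  assumes H: "hilbert_tensor tensor" and v: "square_summable v"
  shows "op_tensor tensor (outer_sum v v) (ketbra \<psi> \<psi>)
    = outer_sum (\<lambda>n. tensor (v n) \<psi>) (\<lambda>n. tensor (v n) \<psi>)"
proof (rule op_tensor_eqI[OF H])
  have t: "square_summable (\<lambda>n. tensor (v n) \<psi>)"
    by (rule square_summable_bounded[OF bounded_clinearD(1)[OF bounded_clinear_tensor(2)[OF H]] v])
  then show "bounded_clinear (outer_sum (\<lambda>n. tensor (v n) \<psi>) (\<lambda>n. tensor (v n) \<psi>))"
    by (intro bounded_clinear_outer_sum)
  fix a b
  have "tensor (outer_sum v v a) (ketbra \<psi> \<psi> b)
      = (\<psi> \<bullet>\<^sub>C b) *\<^sub>C outer_sum (\<lambda>n. tensor (v n) \<psi>) v a"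
    using bounded_clinear_apply_outer_sum[OF bounded_clinear_tensor(2)[OF H] v v, of a \<psi>]
    by (simp add: ketbra_def hilbert_tensorD(4)[OF H])
  then show "outer_sum (\<lambda>n. tensor (v n) \<psi>) (\<lambda>n. tensor (v n) \<psi>) (tensor a b)
      = tensor (outer_sum v v a) (ketbra \<psi> \<psi> b)"
    using has_sum_bounded_linear[OF bounded_linear_scaleC_right has_sum_outer_sum[OF t v], of "\<psi> \<bullet>\<^sub>C b"]
    by (intro outer_sum_eqI)
      (simp add: o_def hilbert_tensorD(5)[OF H] scaleC_scaleC mult.commute)
qed

text \<open>Inserting the basis between z_n and P z_n and exchanging the sums moves the trace from
  basis vectors to the z_n. The \<open>has_sum\<close> form allows conclusions about single terms
  from the value of the trace.\<close>

lemma op_trace_outer_sum: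
  fixes P :: "'a::chilbert_space \<Rightarrow> 'a"
  assumes P: "bounded_clinear P" and z: "square_summable z"
  shows "((\<lambda>n. z n \<bullet>\<^sub>C P (z n)) has_sum op_trace (P \<circ> outer_sum z z)) UNIV"
proof -
  note E = is_onb_some_onb[where 'a = 'a]
  have Pz: "square_summable (\<lambda>n. P (z n))"
    by (rule square_summable_bounded[OF bounded_clinearD(1)[OF P] z])
  show ?thesis
  proof (rule has_sum_iterated_swap[of UNIV some_onb "\<lambda>e n. (z n \<bullet>\<^sub>C e) * (e \<bullet>\<^sub>C P (z n))"
        "\<lambda>n. (norm (z n))\<^sup>2 + (norm (P (z n)))\<^sup>2" "\<lambda>n. z n \<bullet>\<^sub>C P (z n)"
        "\<lambda>e. e \<bullet>\<^sub>C P (outer_sum z z e)"])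
    show "(\<lambda>n. (norm (z n))\<^sup>2 + (norm (P (z n)))\<^sup>2) summable_on UNIV"
      by (intro summable_on_add z Pz)
    show "((\<lambda>e. (z n \<bullet>\<^sub>C e) * (e \<bullet>\<^sub>C P (z n))) has_sum z n \<bullet>\<^sub>C P (z n)) some_onb" for n
      by (rule parseval[OF E])
    show "(\<Sum>e\<in>F. norm ((z n \<bullet>\<^sub>C e) * (e \<bullet>\<^sub>C P (z n)))) \<le> (norm (z n))\<^sup>2 + (norm (P (z n)))\<^sup>2"
      if "finite F" "F \<subseteq> some_onb" for n F
    proof -
      have "(\<Sum>e\<in>F. norm ((z n \<bullet>\<^sub>C e) * (e \<bullet>\<^sub>C P (z n))))
          \<le> (\<Sum>e\<in>F. (cmod (z n \<bullet>\<^sub>C e))\<^sup>2 + (cmod (P (z n) \<bullet>\<^sub>C e))\<^sup>2)"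
        unfolding norm_mult cmod_cinner_commute[of "P (z n)"]
        by (intro sum_mono mult_le_sum_squares)
      then show ?thesis
        using bessel[OF E that(2,1), of "z n"] bessel[OF E that(2,1), of "P (z n)"]
        by (simp add: sum.distrib)
    qed
    show "((\<lambda>n. (z n \<bullet>\<^sub>C e) * (e \<bullet>\<^sub>C P (z n))) has_sum e \<bullet>\<^sub>C P (outer_sum z z e)) UNIV" for e
      using has_sum_bounded_linear[OF bounded_linear_cinner_right has_sum_outer_sum[OF Pz z], of e]
      by (simp add: bounded_clinear_apply_outer_sum[OF P z z] o_def cinner_scaleC_right)
    fix T
    assume "((\<lambda>n. z n \<bullet>\<^sub>C P (z n)) has_sum T) UNIV"
      and "((\<lambda>e. e \<bullet>\<^sub>C P (outer_sum z z e)) has_sum T) some_onb"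
    then show ?thesis by (simp add: op_trace_def infsumI)
  qed
qed

text \<open>Bessel with vector coefficients a_e = (<e| (x) 1) w: for s = sum_e e (x) a_e both <w, s>
  and <s, s> equal N, so |w - s|^2 = |w|^2 - N.\<close>

lemma sum_norm_cadjoint_tensor_le:
  assumes H: "hilbert_tensor tensor" and E: "is_onb E" "F \<subseteq> E" "finite F"
  shows "(\<Sum>e\<in>F. (norm (cadjoint (tensor e) w))\<^sup>2) \<le> (norm w)\<^sup>2"
proof -
  note adj = cinner_cadjoint_right[OF bounded_clinear_tensor(1)[OF H]]
    cinner_cadjoint_left[OF bounded_clinear_tensor(1)[OF H]]
  define a where "a e = cadjoint (tensor e) w" for e
  define s where "s = (\<Sum>e\<in>F. tensor e (a e))"
  define N where "N = (\<Sum>e\<in>F. (norm (a e))\<^sup>2)"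
  have ws: "w \<bullet>\<^sub>C s = complex_of_real N"
    unfolding s_def cinner_sum_right N_def a_def
    by (simp add: cinner_self flip: adj(2))
  have "tensor e (a e) \<bullet>\<^sub>C s = complex_of_real ((norm (a e))\<^sup>2)" if "e \<in> F" for e
  proof -
    have "tensor e (a e) \<bullet>\<^sub>C s = (\<Sum>f\<in>F. if f = e then complex_of_real ((norm (a e))\<^sup>2) else 0)"
      unfolding s_def cinner_sum_right hilbert_tensorD(5)[OF H]
      using that E(2) by (intro sum.cong) (auto simp: is_onbD[OF E(1)] cinner_self subset_iff)
    then show ?thesis using that E(3) by simp
  qed
  then have "s \<bullet>\<^sub>C s = complex_of_real N"
    unfolding N_def by (subst (1) s_def) (simp add: cinner_sum_left)
  then have "(norm s)\<^sup>2 = N" unfolding cinner_self by (simp only: of_real_eq_iff)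
  then have "0 \<le> (norm w)\<^sup>2 - N"
    using norm_diff_square[of w s] zero_le_power2[of "norm (w - s)"] by (simp add: ws)
  then show ?thesis unfolding N_def a_def by simp
qed

text \<open>For a single operator $|w\rangle\langle u|$ the sum over the basis amounts to expanding
  \<open>g = (1 \<otimes> \<langle>y|) u\<close>.\<close>

lemma partial_trace_rank_one:
  assumes H: "hilbert_tensor tensor" and E: "is_onb E"
  shows "((\<lambda>e. (u \<bullet>\<^sub>C tensor e y) *\<^sub>C cadjoint (tensor e) w) has_sum
    cadjoint (tensor (cadjoint (\<lambda>a. tensor a y) u)) w) E"
proof -
  define g where "g = cadjoint (\<lambda>a. tensor a y) u"
  note adj = cinner_cadjoint_left[OF bounded_clinear_tensor(1)[OF H]]
  have g: "g \<bullet>\<^sub>C e = u \<bullet>\<^sub>C tensor e y" for e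
    unfolding g_def by (rule cinner_cadjoint_left[OF bounded_clinear_tensor(2)[OF H]])
  have scale: "cadjoint (tensor (c *\<^sub>C a)) w = cnj c *\<^sub>C cadjoint (tensor a) w" for c a
    by (rule cinner_ext_left) (simp add: adj hilbert_tensorD(3)[OF H] cinner_simps)
  \<comment> \<open>The map a |-> (<a| (x) 1) w is antilinear, hence only real-linear. The conjugate
    it puts on <e, g> produces <g, e> = <u, e (x) y>.\<close>
  have "bounded_linear (\<lambda>a. cadjoint (tensor a) w)"
  proof (rule bounded_linear_intro[where K = "norm w"])
    show "cadjoint (tensor (a + b)) w = cadjoint (tensor a) w + cadjoint (tensor b) w" for a b
      by (rule cinner_ext_left) (simp add: adj hilbert_tensorD(1)[OF H] cinner_simps)
    show "cadjoint (tensor (r *\<^sub>R a)) w = r *\<^sub>R cadjoint (tensor a) w" for r a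
      by (simp add: scaleR_scaleC scale)
    show "norm (cadjoint (tensor a) w) \<le> norm a * norm w" for a
      using norm_cadjoint_le[OF bounded_clinear_tensor(1)[OF H], of a "norm a" w]
      by (simp add: norm_tensor[OF H] mult.commute)
  qed
  then have "((\<lambda>e. cadjoint (tensor ((e \<bullet>\<^sub>C g) *\<^sub>C e)) w) has_sum cadjoint (tensor g) w) E"
    using has_sum_bounded_linear[where h = "\<lambda>a. cadjoint (tensor a) w", OF _ onb_expansion[OF E, of g]]
    by (simp add: o_def)
  then show ?thesis
    unfolding scale cinner_commute[symmetric] g unfolding g_def .
qed

text \<open>This is \<open>tr\<^sub>K (A (P \<otimes> 1)) = tr\<^sub>K ((P \<otimes> 1) A)\<close> in the special case where
  \<open>A = (P \<otimes> 1) A\<close> and \<open>A (P \<otimes> 1) = 0\<close>.\<close>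

lemma partial_trace_off_diagonal:
  assumes H: "hilbert_tensor tensor"
    and w: "square_summable w" and u: "square_summable u"
    and P': "\<And>x y. x \<bullet>\<^sub>C P' y = P' x \<bullet>\<^sub>C y" "\<And>a b. P' (tensor a b) = tensor (P a) b"
    and P: "\<And>x y. x \<bullet>\<^sub>C P y = P x \<bullet>\<^sub>C y"
    and Pw: "\<And>n. P' (w n) = w n" and Pu: "\<And>n. P' (u n) = 0"
  shows "((\<lambda>e. cadjoint (tensor e) (outer_sum w u (tensor e y))) has_sum 0) some_onb"
proof -
  note E = is_onb_some_onb[where 'a = 'a]
  note Rb = bounded_clinear_tensor(2)[OF H, of y]
  note adj = cinner_cadjoint_left[OF bounded_clinear_tensor(1)[OF H]]
  define g where "g n = cadjoint (\<lambda>a. tensor a y) (u n)" for n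
  have g: "g n \<bullet>\<^sub>C a = u n \<bullet>\<^sub>C tensor a y" for n a
    unfolding g_def by (rule cinner_cadjoint_left[OF Rb])
  \<comment> \<open><P g_n, a> = <u_n, P a (x) y> = <P' u_n, a (x) y> = 0.\<close>
  have Pg: "P (g n) = 0" for n
    by (rule cinner_ext_left) (simp add: g Pu P'(1) flip: P P'(2))
  \<comment> \<open>Writing w_n as P' w_n and shifting P' to the other side replaces g_n by P g_n =
    0.\<close>
  have zero: "cadjoint (tensor (g n)) (w n) = 0" for n
  proof (rule cinner_ext_left)
    fix b
    have "w n \<bullet>\<^sub>C tensor (g n) b = w n \<bullet>\<^sub>C tensor (P (g n)) b"
      by (subst (1) Pw[symmetric]) (simp flip: P')
    also have "\<dots> = 0"
      using bounded_clinearD(5)[OF bounded_clinear_tensor(2)[OF H]] by (simp add: Pg)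
    finally show "cadjoint (tensor (g n)) (w n) \<bullet>\<^sub>C b = 0 \<bullet>\<^sub>C b" by (simp add: adj)
  qed
  have gs: "square_summable g"
    unfolding g_def
    by (rule square_summable_bounded[OF bounded_clinearD(1)[OF bounded_clinear_cadjoint[OF Rb]] u])
  show ?thesis
  \<comment> \<open>Summed over the basis first, every n contributes 0; the majorant combines the
    scalar and the vector-valued Bessel inequality.\<close>
  proof (rule has_sum_iterated_swap[of UNIV some_onb
        "\<lambda>e n. (u n \<bullet>\<^sub>C tensor e y) *\<^sub>C cadjoint (tensor e) (w n)"
        "\<lambda>n. (norm (g n))\<^sup>2 + (norm (w n))\<^sup>2" "\<lambda>n. 0"
        "\<lambda>e. cadjoint (tensor e) (outer_sum w u (tensor e y))"])
    show "(\<lambda>n. (norm (g n))\<^sup>2 + (norm (w n))\<^sup>2) summable_on UNIV"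
      by (intro summable_on_add gs w)
    show "((\<lambda>e. (u n \<bullet>\<^sub>C tensor e y) *\<^sub>C cadjoint (tensor e) (w n)) has_sum 0) some_onb" for n
      using partial_trace_rank_one[OF H E, of "u n" y "w n"] unfolding g_def[symmetric] zero .
    show "(\<Sum>e\<in>F. norm ((u n \<bullet>\<^sub>C tensor e y) *\<^sub>C cadjoint (tensor e) (w n)))
        \<le> (norm (g n))\<^sup>2 + (norm (w n))\<^sup>2" if "finite F" "F \<subseteq> some_onb" for n F
    proof -
      have "(\<Sum>e\<in>F. norm ((u n \<bullet>\<^sub>C tensor e y) *\<^sub>C cadjoint (tensor e) (w n)))
          \<le> (\<Sum>e\<in>F. (cmod (g n \<bullet>\<^sub>C e))\<^sup>2 + (norm (cadjoint (tensor e) (w n)))\<^sup>2)"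
        unfolding norm_scaleC g by (intro sum_mono mult_le_sum_squares)
      then show ?thesis
        using bessel[OF E that(2,1), of "g n"]
          sum_norm_cadjoint_tensor_le[OF H E that(2,1), of "w n"]
        by (simp add: sum.distrib)
    qed
    show "((\<lambda>n. (u n \<bullet>\<^sub>C tensor e y) *\<^sub>C cadjoint (tensor e) (w n)) has_sum
        cadjoint (tensor e) (outer_sum w u (tensor e y))) UNIV" for e
    proof -
      note ad = bounded_clinear_cadjoint[OF bounded_clinear_tensor(1)[OF H, of e]]
      show ?thesis
        using has_sum_bounded_linear[OF bounded_clinearD(1)[OF ad] has_sum_outer_sum[OF w u]]
        by (simp add: o_def bounded_clinearD[OF ad])
    qed
    fix T :: 'b
    assume 0: "((\<lambda>n::nat. 0) has_sum T) UNIV"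
      and *: "((\<lambda>e. cadjoint (tensor e) (outer_sum w u (tensor e y))) has_sum T) some_onb"
    have "T = 0" by (rule has_sum_unique[OF 0]) simp
    then show ?thesis using * by simp
  qed
qed

text \<open>If f diverges, so does f + g, and both sides take the default value 0. The vanishing
  cross term can thus be dropped whether or not the diagonal part converges.\<close>

lemma infsum_add_has_sum_zero:
  fixes f g :: "'i \<Rightarrow> 'a::real_normed_vector"
  assumes "(g has_sum 0) A"
  shows "infsum (\<lambda>x. f x + g x) A = infsum f A"
proof (cases "f summable_on A")
  case True
  then show ?thesis
    using has_sum_add[OF has_sum_infsum assms] by (simp add: infsumI)
next
  case False
  moreover have "\<not> (\<lambda>x. f x + g x) summable_on A"
  proof
    assume "(\<lambda>x. f x + g x) summable_on A"
    then have "(\<lambda>x. (f x + g x) + - g x) summable_on A"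
      by (rule summable_on_add) (use assms in \<open>auto simp: summable_on_uminus summable_on_def\<close>)
    then show False using False by simp
  qed
  ultimately show ?thesis by (simp add: infsum_not_exists)
qed

text \<open>The bra is antilinear, whence the coefficients a \<open>cnj a\<close> and a
  \<open>cnj b\<close>.\<close>

lemma outer_sum_diagonal_plus_cross:
  assumes w: "square_summable w" and u: "square_summable u"
  shows "outer_sum (\<lambda>n. a *\<^sub>C w n) (\<lambda>n. b *\<^sub>C u n + a *\<^sub>C w n) x
    = (cmod a)\<^sup>2 *\<^sub>R outer_sum w w x + (a * cnj b) *\<^sub>C outer_sum w u x"
proof (rule outer_sum_eqI)
  have "((b *\<^sub>C u n + a *\<^sub>C w n) \<bullet>\<^sub>C x) *\<^sub>C a *\<^sub>C w n
      = complex_of_real ((cmod a)\<^sup>2) *\<^sub>C (w n \<bullet>\<^sub>C x) *\<^sub>C w n + (a * cnj b) *\<^sub>C (u n \<bullet>\<^sub>C x) *\<^sub>C w n" for n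
    unfolding complex_norm_square
    by (simp add: cinner_simps scaleC_scaleC algebra_simps flip: scaleC_add_left)
  then show "((\<lambda>n. ((b *\<^sub>C u n + a *\<^sub>C w n) \<bullet>\<^sub>C x) *\<^sub>C a *\<^sub>C w n) has_sum
      (cmod a)\<^sup>2 *\<^sub>R outer_sum w w x + (a * cnj b) *\<^sub>C outer_sum w u x) UNIV"
    using has_sum_add[OF
        has_sum_bounded_linear[OF bounded_linear_scaleC_right has_sum_outer_sum[OF w w]]
        has_sum_bounded_linear[OF bounded_linear_scaleC_right has_sum_outer_sum[OF w u]]]
    unfolding scaleR_scaleC by (simp add: o_def)
qed

text \<open>Stated for an abstract pair P, P' so that it serves both Q and 1 - Q, the latter with u
  and w interchanged.\<close>

lemma partial_trace_diagonal_plus_cross: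
  assumes H: "hilbert_tensor tensor"
    and w: "square_summable w" and u: "square_summable u"
    and P': "\<And>x y. x \<bullet>\<^sub>C P' y = P' x \<bullet>\<^sub>C y" "\<And>a b. P' (tensor a b) = tensor (P a) b"
    and P: "\<And>x y. x \<bullet>\<^sub>C P y = P x \<bullet>\<^sub>C y"
    and Pw: "\<And>n. P' (w n) = w n" and Pu: "\<And>n. P' (u n) = 0"
  shows "partial_trace tensor (outer_sum (\<lambda>n. a *\<^sub>C w n) (\<lambda>n. b *\<^sub>C u n + a *\<^sub>C w n))
    = (\<lambda>y. (cmod a)\<^sup>2 *\<^sub>R partial_trace tensor (outer_sum w w) y)"
proof
  fix y
  have lin: "cadjoint (tensor e) (r *\<^sub>R x + c *\<^sub>C x')
      = r *\<^sub>R cadjoint (tensor e) x + c *\<^sub>C cadjoint (tensor e) x'" for e r x c x'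
    using bounded_clinearD(2,3)[OF bounded_clinear_cadjoint[OF bounded_clinear_tensor(1)[OF H]]]
    by (simp add: scaleR_scaleC)
  have "((\<lambda>e. (a * cnj b) *\<^sub>C cadjoint (tensor e) (outer_sum w u (tensor e y))) has_sum 0) some_onb"
    using has_sum_bounded_linear[OF bounded_linear_scaleC_right
        partial_trace_off_diagonal[OF assms, of y], of "a * cnj b"]
    by (simp add: o_def)
  then show "partial_trace tensor (outer_sum (\<lambda>n. a *\<^sub>C w n) (\<lambda>n. b *\<^sub>C u n + a *\<^sub>C w n)) y
      = (cmod a)\<^sup>2 *\<^sub>R partial_trace tensor (outer_sum w w) y"
    unfolding partial_trace_def outer_sum_diagonal_plus_cross[OF w u] lin infsum_scaleR_right[symmetric]
    by (rule infsum_add_has_sum_zero)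
qed

theorem mainTheorem3:
  fixes tensor :: "'k::chilbert_space \<Rightarrow> 'h::chilbert_space \<Rightarrow> 't::chilbert_space"
    and \<tau> Q :: "'k \<Rightarrow> 'k"
    and U :: "'t \<Rightarrow> 't"
    and \<psi>\<^sub>0 \<psi>\<^sub>1 \<psi> :: 'h
    and T :: "('h \<Rightarrow> 'h) \<Rightarrow> ('t \<Rightarrow> 't)"
    and M :: "('h \<Rightarrow> 'h) \<Rightarrow> ('h \<Rightarrow> 'h) \<times> ('h \<Rightarrow> 'h)"
    and \<alpha>\<^sub>0 \<alpha>\<^sub>1 :: complex
  assumes "hilbert_tensor tensor"
    and "is_state \<tau>"
    and "unitary_op U"
    and "norm \<psi>\<^sub>0 = 1" and "norm \<psi>\<^sub>1 = 1"
    and "\<And>\<rho>. trace_class \<rho> \<Longrightarrow> T \<rho> = U \<circ> op_tensor tensor \<tau> \<rho> \<circ> cadjoint U"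
    and "orthogonal_projection Q"
    and "op_trace (op_tensor tensor Q id \<circ> T (ketbra \<psi>\<^sub>0 \<psi>\<^sub>0)) = 0"
    and "op_trace (op_tensor tensor Q id \<circ> T (ketbra \<psi>\<^sub>1 \<psi>\<^sub>1)) = 1"
    and "\<And>\<rho>. trace_class \<rho> \<Longrightarrow>
           M \<rho> = (partial_trace tensor (op_tensor tensor (\<lambda>x. x - Q x) id \<circ> T \<rho>),
                  partial_trace tensor (op_tensor tensor Q id \<circ> T \<rho>))"
    and "\<psi> = \<alpha>\<^sub>0 *\<^sub>C \<psi>\<^sub>0 + \<alpha>\<^sub>1 *\<^sub>C \<psi>\<^sub>1"
  shows "M (ketbra \<psi> \<psi>) =
          ((\<lambda>x. (cmod \<alpha>\<^sub>0)\<^sup>2 *\<^sub>R partial_trace tensor (T (ketbra \<psi>\<^sub>0 \<psi>\<^sub>0)) x),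
           (\<lambda>x. (cmod \<alpha>\<^sub>1)\<^sup>2 *\<^sub>R partial_trace tensor (T (ketbra \<psi>\<^sub>1 \<psi>\<^sub>1)) x))"
proof -
  let ?Q' = "op_tensor tensor Q id"
  note H = assms(1) and T = assms(6) and Q = assms(7) and M = assms(10)
  note Q' = op_tensor_projection[OF H Q]
  have U: "bounded_clinear U" and UU: "\<And>x. cadjoint U (U x) = x"
    using assms(3) unfolding unitary_op_def by (auto simp: fun_eq_iff)
  have tau: "positive_op \<tau>" and "op_trace \<tau> = 1"
    using assms(2) unfolding is_state_def by auto
  \<comment> \<open>A divergent \<^const>\<open>infsum\<close> is 0, so trace 1 already yields convergence.\<close>
  then have "((\<lambda>e. e \<bullet>\<^sub>C \<tau> e) has_sum 1) some_onb"
    unfolding op_trace_def by (metis has_sum_infsum infsum_not_exists zero_neq_one)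
  then obtain v where "((\<lambda>n. (norm (v n))\<^sup>2) has_sum Re 1) UNIV" and \<tau>: "\<tau> = outer_sum v v"
    using positive_op_decomposition[OF tau is_onb_some_onb] by blast
  then have v1: "((\<lambda>n. (norm (v n))\<^sup>2) has_sum 1) UNIV" by simp
  then have v: "square_summable v" unfolding summable_on_def by blast
  define z where "z \<phi> n = U (tensor (v n) \<phi>)" for \<phi> n
  have t: "square_summable (\<lambda>n. tensor (v n) \<phi>)" for \<phi>
    by (rule square_summable_bounded[OF bounded_clinearD(1)[OF bounded_clinear_tensor(2)[OF H]] v])
  have z: "square_summable (z \<phi>)" for \<phi>
    unfolding z_def by (rule square_summable_bounded[OF bounded_clinearD(1)[OF U] t])
  have norm_z: "norm (z \<phi> n) = norm (v n) * norm \<phi>" for \<phi> n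
  proof -
    have "U x \<bullet>\<^sub>C U x = x \<bullet>\<^sub>C x" for x
      using cinner_cadjoint_left[OF U, of "U x" x] by (simp add: UU)
    then have "(norm (U x))\<^sup>2 = (norm x)\<^sup>2" for x
      unfolding cinner_self of_real_eq_iff .
    then have "norm (U x) = norm x" for x
      by (simp add: power2_eq_iff_nonneg)
    then show ?thesis unfolding z_def by (simp add: norm_tensor[OF H])
  qed
  have Tz: "T (ketbra \<phi> \<phi>) = outer_sum (z \<phi>) (z \<phi>)" for \<phi>
  proof
    fix x
    have "T (ketbra \<phi> \<phi>) x = outer_sum (z \<phi>) (\<lambda>n. tensor (v n) \<phi>) (cadjoint U x)"
      unfolding T[OF trace_class_ketbra] \<tau> op_tensor_ketbra[OF H v] z_def
      by (simp add: bounded_clinear_apply_outer_sum[OF U t t])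
    then show "T (ketbra \<phi> \<phi>) x = outer_sum (z \<phi>) (z \<phi>) x"
      unfolding outer_sum_def z_def by (simp add: cinner_cadjoint_right[OF U])
  qed
  \<comment> \<open>As Q' is a selfadjoint idempotent, <z, Q' z> = |Q' z|^2, so the trace is a sum
    of nonnegative terms.\<close>
  have tr: "((\<lambda>n. (norm (?Q' (z \<phi> n)))\<^sup>2) has_sum Re (op_trace (?Q' \<circ> T (ketbra \<phi> \<phi>)))) UNIV" for \<phi>
  proof -
    have "x \<bullet>\<^sub>C ?Q' x = complex_of_real ((norm (?Q' x))\<^sup>2)" for x
      unfolding cinner_self[symmetric] Q'(3) Q'(4) ..
    then show ?thesis
      using has_sum_Re[OF op_trace_outer_sum[OF Q'(1) z, of \<phi>]]
      unfolding Tz by (simp only: Re_complex_of_real)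
  qed
  have Qu: "?Q' (z \<psi>\<^sub>0 n) = 0" for n
    using nonneg_has_sum_le_0D[OF tr[of \<psi>\<^sub>0], of n] assms(8) by simp
  have Qw: "?Q' (z \<psi>\<^sub>1 n) = z \<psi>\<^sub>1 n" for n
  proof -
    \<comment> \<open>The weight of w_n outside the range of Q'. These weights sum to 1 - 1 = 0: the
      trace of tau minus the trace assumed for psi_1.\<close>
    have pyth: "(norm (z \<psi>\<^sub>1 n - ?Q' (z \<psi>\<^sub>1 n)))\<^sup>2 = (norm (v n))\<^sup>2 - (norm (?Q' (z \<psi>\<^sub>1 n)))\<^sup>2" for n
    proof -
      have "z \<psi>\<^sub>1 n \<bullet>\<^sub>C ?Q' (z \<psi>\<^sub>1 n) = ?Q' (z \<psi>\<^sub>1 n) \<bullet>\<^sub>C ?Q' (z \<psi>\<^sub>1 n)"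
        unfolding Q'(3) Q'(4) ..
      then show ?thesis
        by (simp add: norm_diff_square cinner_self norm_z assms(5) del: of_real_power)
    qed
    have "((\<lambda>n. (norm (v n))\<^sup>2 - (norm (?Q' (z \<psi>\<^sub>1 n)))\<^sup>2) has_sum 0) UNIV"
      using has_sum_add[OF v1 has_sum_uminusI[OF tr[of \<psi>\<^sub>1]]] assms(9) by simp
    then have "((\<lambda>n. (norm (z \<psi>\<^sub>1 n - ?Q' (z \<psi>\<^sub>1 n)))\<^sup>2) has_sum 0) UNIV"
      unfolding pyth .
    from nonneg_has_sum_le_0D[OF this, of n] show ?thesis by simp
  qed
  have z\<psi>: "z \<psi> n = \<alpha>\<^sub>0 *\<^sub>C z \<psi>\<^sub>0 n + \<alpha>\<^sub>1 *\<^sub>C z \<psi>\<^sub>1 n" for n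
    unfolding z_def assms(11)
    by (simp add: hilbert_tensorD(2,4)[OF H] bounded_clinearD(2,3)[OF U])
  have lin: "?Q' (z \<psi> n) = \<alpha>\<^sub>1 *\<^sub>C z \<psi>\<^sub>1 n" for n
    unfolding z\<psi> by (simp add: bounded_clinearD(2,3)[OF Q'(1)] Qu Qw)
  note Qb' = bounded_clinear_diff[OF bounded_clinear_id Q'(1)]
  have z\<psi>': "z \<psi> = (\<lambda>n. \<alpha>\<^sub>0 *\<^sub>C z \<psi>\<^sub>0 n + \<alpha>\<^sub>1 *\<^sub>C z \<psi>\<^sub>1 n)"
    by (rule ext) (rule z\<psi>)
  have "?Q' \<circ> T (ketbra \<psi> \<psi>) = outer_sum (\<lambda>n. ?Q' (z \<psi> n)) (z \<psi>)"
    unfolding Tz by (auto simp: bounded_clinear_apply_outer_sum[OF Q'(1) z z])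
  then have "?Q' \<circ> T (ketbra \<psi> \<psi>)
      = outer_sum (\<lambda>n. \<alpha>\<^sub>1 *\<^sub>C z \<psi>\<^sub>1 n) (\<lambda>n. \<alpha>\<^sub>0 *\<^sub>C z \<psi>\<^sub>0 n + \<alpha>\<^sub>1 *\<^sub>C z \<psi>\<^sub>1 n)"
    unfolding lin unfolding z\<psi>' .
  then have 1: "partial_trace tensor (?Q' \<circ> T (ketbra \<psi> \<psi>))
      = (\<lambda>y. (cmod \<alpha>\<^sub>1)\<^sup>2 *\<^sub>R partial_trace tensor (T (ketbra \<psi>\<^sub>1 \<psi>\<^sub>1)) y)"
    unfolding Tz[of \<psi>\<^sub>1]
    by (simp only:)
      (rule partial_trace_diagonal_plus_cross[OF H z z Q'(3,2) orthogonal_projectionD(1)[OF Q] Qw Qu])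
  have lin': "z \<psi> n - ?Q' (z \<psi> n) = \<alpha>\<^sub>0 *\<^sub>C z \<psi>\<^sub>0 n" for n
    unfolding lin by (simp add: z\<psi>)
  have "(\<lambda>x. x - ?Q' x) \<circ> T (ketbra \<psi> \<psi>) = outer_sum (\<lambda>n. z \<psi> n - ?Q' (z \<psi> n)) (z \<psi>)"
    unfolding Tz using bounded_clinear_apply_outer_sum[OF Qb' z z] by (auto simp: fun_eq_iff)
  then have "(\<lambda>x. x - ?Q' x) \<circ> T (ketbra \<psi> \<psi>)
      = outer_sum (\<lambda>n. \<alpha>\<^sub>0 *\<^sub>C z \<psi>\<^sub>0 n) (\<lambda>n. \<alpha>\<^sub>1 *\<^sub>C z \<psi>\<^sub>1 n + \<alpha>\<^sub>0 *\<^sub>C z \<psi>\<^sub>0 n)"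
    \<comment> \<open>The summands are exchanged so that the family surviving on the ket side comes
      last.\<close>
    unfolding lin' unfolding z\<psi>' by (simp only: add.commute)
  moreover have "partial_trace tensor
      (outer_sum (\<lambda>n. \<alpha>\<^sub>0 *\<^sub>C z \<psi>\<^sub>0 n) (\<lambda>n. \<alpha>\<^sub>1 *\<^sub>C z \<psi>\<^sub>1 n + \<alpha>\<^sub>0 *\<^sub>C z \<psi>\<^sub>0 n))
      = (\<lambda>y. (cmod \<alpha>\<^sub>0)\<^sup>2 *\<^sub>R partial_trace tensor (outer_sum (z \<psi>\<^sub>0) (z \<psi>\<^sub>0)) y)"
  \<comment> \<open>Under 1 - Q the family of psi_0 is fixed and that of psi_1 is
    annihilated.\<close>
  proof (rule partial_trace_diagonal_plus_cross[OF H z z,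
        where P' = "\<lambda>x. x - ?Q' x" and P = "\<lambda>x. x - Q x"])
    show "x \<bullet>\<^sub>C (y - ?Q' y) = (x - ?Q' x) \<bullet>\<^sub>C y" for x y
      by (simp add: cinner_simps Q'(3))
    show "x \<bullet>\<^sub>C (y - Q y) = (x - Q x) \<bullet>\<^sub>C y" for x y
      by (simp add: cinner_simps orthogonal_projectionD(1)[OF Q])
    show "tensor a b - ?Q' (tensor a b) = tensor (a - Q a) b" for a b
      using bounded_clinearD(4)[OF bounded_clinear_tensor(2)[OF H]] by (simp add: Q'(2))
  qed (simp_all add: Qu Qw)
  ultimately have 0: "partial_trace tensor (op_tensor tensor (\<lambda>x. x - Q x) id \<circ> T (ketbra \<psi> \<psi>))
      = (\<lambda>y. (cmod \<alpha>\<^sub>0)\<^sup>2 *\<^sub>R partial_trace tensor (T (ketbra \<psi>\<^sub>0 \<psi>\<^sub>0)) y)"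
    unfolding Q'(5) Tz[of \<psi>\<^sub>0] by simp
  show ?thesis unfolding M[OF trace_class_ketbra] 0 1 ..
qed

end
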